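(* Let $0<h<1$, $\rho>0$, $f^*\in L^2(\Omega)$, $j_\delta\in H^{-1/2}(\partial\Omega)$ and $g_\delta\in H^{1/2}_\diamond(\partial\Omega)\cap\gamma(\mathcal V^h_1)$. Then the problem $$\min_{f\in L^2(\Omega)}\Upsilon^h_{\rho,\delta}(f),\qquad \Upsilon^h_{\rho,\delta}(f):=\mathcal J^h_\delta(f)+\rho\|f-f^*\|^2_{L^2(\Omega)},$$ has a unique minimizer $f$, and it satisfies $$f-f^*=-\frac1\rho\big(\mathcal N^h_fj_\delta-\mathcal D^h_fg_\delta\big).$$
   Context: Standing setting: $\Omega\subset\mathbb{R}^d$, $d\in\{2,3\}$, is open, bounded, connected with Lipschitz (polygonal/polyhedral) boundary. $Q=(q_{rs})\in L^\infty(\Omega)^{d\times d}$ is symmetric with $Q(x)\xi\cdot\xi\ge\underline{q}|\xi|^2$ a.e., $\underline q>0$. $\gamma$ is the trace operator $H^1(\Omega)\to H^{1/2}(\partial\Omega)$, $H^{-1/2}(\partial\Omega)$ the dual of $H^{1/2}(\partial\Omega)$ with pairing $\langle\cdot,\cdot\rangle$, $(\cdot,\cdot)$ the $L^2(\Omega)$ inner product. $H^1_0(\Omega)=\ker\gamma$, $H^1_\diamond(\Omega)=\{u\in H^1(\Omega):\int_{\partial\Omega}\gamma u=0\}$, $H^{1/2}_\diamond(\partial\Omega)=\{g\in H^{1/2}(\partial\Omega):\int_{\partial\Omega}g=0\}$. Discretization: $(\mathcal T^h)_{0<h<1}$ is a family of regular, quasi-uniform triangulations of $\overline\Omega$ with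 mesh size $h$; $\mathcal V^h_1=\{v\in C(\overline\Omega): v|_T\text{ affine }\forall T\in\mathcal T^h\}$, $\mathcal V^h_{1,\diamond}=\mathcal V^h_1\cap H^1_\diamond(\Omega)$, $\mathcal V^h_{1,0}=\mathcal V^h_1\cap H^1_0(\Omega)$. Discrete Neumann operator: for $f\in L^2(\Omega)$, $j\in H^{-1/2}(\partial\Omega)$, $\mathcal N^h_fj$ is the unique $u^h\in\mathcal V^h_{1,\diamond}$ with $\int_\Omega Q\nabla u^h\cdot\nabla\varphi^h=(f,\varphi^h)+\langle j,\gamma\varphi^h\rangle$ for all $\varphi^h\in\mathcal V^h_{1,\diamond}$. Discrete Dirichlet operator: for $f\in L^2(\Omega)$ and $g\in H^{1/2}_\diamond(\partial\Omega)$ which is the trace of some function of $\mathcal V^h_1$, $\mathcal D^h_fg$ is the unique $v^h\in\mathcal V^h_1$ with $\gamma v^h=g$ and $\int_\Omega Q\nabla v^h\cdot\nabla\psi^h=(f,\psi^h)$ for all $\psi^h\in\mathcal V^h_{1,0}$. $\mathcal J^h_\delta(f):=\int_\Omega Q\nabla(\mathcal N^h_fj_\delta-\mathcal D^h_fg_\delta)\cdot\nabla(\mathcal N^h_fj_\delta-\mathcal D^h_fg_\delta)$. *)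

theory Defs
  imports "HOL-Analysis.Analysis"
begin

text \<open>Lipschitz boundary: near every boundary point, after a rigid rotation, the domain is
  the subgraph of a Lipschitz function of the remaining d-1 coordinates.\<close>
definition lipschitz_boundary :: "(real^'n) set \<Rightarrow> bool" where
  "lipschitz_boundary \<Omega> \<longleftrightarrow>
     (\<forall>x0\<in>frontier \<Omega>. \<exists>r>0. \<exists>(R :: real^'n \<Rightarrow> real^'n) (k :: 'n) (\<psi> :: real^'n \<Rightarrow> real) (L :: real).
        orthogonal_transformation R \<and>
        (\<forall>y z. (\<forall>i. i \<noteq> k \<longrightarrow> y $ i = z $ i) \<longrightarrow> \<psi> y = \<psi> z) \<and>
        (\<forall>y z. \<bar>\<psi> y - \<psi> z\<bar> \<le> L * norm (y - z)) \<and>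
        (\<forall>x\<in>ball x0 r. x \<in> \<Omega> \<longleftrightarrow> (R (x - x0)) $ k < \<psi> (R (x - x0))))"

definition admissible_coefficient :: "(real^'n) set \<Rightarrow> (real^'n \<Rightarrow> real^'n^'n) \<Rightarrow> real \<Rightarrow> bool" where
  "admissible_coefficient \<Omega> Q qlow \<longleftrightarrow>
     0 < qlow \<and>
     (\<forall>r s. (\<lambda>x. Q x $ r $ s) \<in> borel_measurable (lebesgue_on \<Omega>)) \<and>
     (\<exists>M. \<forall>r s. AE x in lebesgue_on \<Omega>. \<bar>Q x $ r $ s\<bar> \<le> M) \<and>
     (AE x in lebesgue_on \<Omega>. transpose (Q x) = Q x) \<and>
     (AE x in lebesgue_on \<Omega>. \<forall>\<xi>. (Q x *v \<xi>) \<bullet> \<xi> \<ge> qlow * (norm \<xi>)\<^sup>2)"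

definition inradius :: "(real^'n) set \<Rightarrow> real" where
  "inradius T = Sup {r. \<exists>c. ball c r \<subseteq> T}"

definition regular_quasi_uniform_family :: "(real^'n) set \<Rightarrow> (real \<Rightarrow> (real^'n) set set) \<Rightarrow> bool" where
  "regular_quasi_uniform_family \<Omega> \<T> \<longleftrightarrow>
     (\<forall>h. 0 < h \<and> h < 1 \<longrightarrow>
        triangulation (\<T> h) \<and> \<Union>(\<T> h) = closure \<Omega> \<and>
        (\<forall>T\<in>\<T> h. int CARD('n) simplex T) \<and>
        Max (diameter ` \<T> h) = h) \<and>
     (\<exists>\<sigma>. \<forall>h. 0 < h \<and> h < 1 \<longrightarrow> (\<forall>T\<in>\<T> h. diameter T \<le> \<sigma> * inradius T)) \<and>
     (\<exists>c>0. \<forall>h. 0 < h \<and> h < 1 \<longrightarrow> (\<forall>T\<in>\<T> h. c * h \<le> diameter T))"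

definition L2 :: "(real^'n) set \<Rightarrow> (real^'n \<Rightarrow> real) set" where
  "L2 \<Omega> = {f. f \<in> borel_measurable (lebesgue_on \<Omega>) \<and>
                integrable (lebesgue_on \<Omega>) (\<lambda>x. (f x)\<^sup>2)}"

definition L2_inner :: "(real^'n) set \<Rightarrow> (real^'n \<Rightarrow> real) \<Rightarrow> (real^'n \<Rightarrow> real) \<Rightarrow> real" where
  "L2_inner \<Omega> f g = integral\<^sup>L (lebesgue_on \<Omega>) (\<lambda>x. f x * g x)"

definition hausdorff_outer :: "real \<Rightarrow> 'a::metric_space set \<Rightarrow> ennreal" where
  "hausdorff_outer s A =
     (SUP \<delta>\<in>{0<..}. INF C \<in> {C :: nat \<Rightarrow> 'a set. A \<subseteq> (\<Union>i. C i) \<and>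
                                   (\<forall>i. bounded (C i) \<and> diameter (C i) \<le> \<delta>)}.
        (\<Sum>i. ennreal ((pi powr (s / 2) / Gamma (s / 2 + 1)) * (diameter (C i) / 2) powr s)))"

definition surface_measure :: "(real^'n) set \<Rightarrow> (real^'n) measure" where
  "surface_measure \<Omega> =
     measure_of (frontier \<Omega>) (sets (restrict_space borel (frontier \<Omega>)))
       (hausdorff_outer (real CARD('n) - 1))"

definition boundary_integral :: "(real^'n) set \<Rightarrow> (real^'n \<Rightarrow> real) \<Rightarrow> real" where
  "boundary_integral \<Omega> g = integral\<^sup>L (surface_measure \<Omega>) g"

text \<open>H^{1/2}(boundary) via the Sobolev--Slobodeckij (Gagliardo) norm, s = 1/2 on the
  (d-1)-dimensional boundary, i.e. kernel |x-y|^(-(d-1)-2s) = |x-y|^(-d).\<close>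
definition gagliardo_integrand :: "(real^'n \<Rightarrow> real) \<Rightarrow> ((real^'n) \<times> (real^'n)) \<Rightarrow> real" where
  "gagliardo_integrand g = (\<lambda>(x, y). (g x - g y)\<^sup>2 / norm (x - y) powr real CARD('n))"

definition H_half :: "(real^'n) set \<Rightarrow> (real^'n \<Rightarrow> real) set" where
  "H_half \<Omega> = {g. g \<in> borel_measurable (surface_measure \<Omega>) \<and>
                   integrable (surface_measure \<Omega>) (\<lambda>x. (g x)\<^sup>2) \<and>
                   integrable (surface_measure \<Omega> \<Otimes>\<^sub>M surface_measure \<Omega>) (gagliardo_integrand g)}"

definition H_half_norm :: "(real^'n) set \<Rightarrow> (real^'n \<Rightarrow> real) \<Rightarrow> real" where
  "H_half_norm \<Omega> g = sqrt (integral\<^sup>L (surface_measure \<Omega>) (\<lambda>x. (g x)\<^sup>2) +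
                          integral\<^sup>L (surface_measure \<Omega> \<Otimes>\<^sub>M surface_measure \<Omega>) (gagliardo_integrand g))"

definition H_half_diamond :: "(real^'n) set \<Rightarrow> (real^'n \<Rightarrow> real) set" where
  "H_half_diamond \<Omega> = {g \<in> H_half \<Omega>. boundary_integral \<Omega> g = 0}"

text \<open>H^{-1/2}(boundary): bounded linear functionals on H^{1/2}(boundary);
  the duality pairing <j, g> is the application j g.\<close>
definition H_minus_half :: "(real^'n) set \<Rightarrow> ((real^'n \<Rightarrow> real) \<Rightarrow> real) set" where
  "H_minus_half \<Omega> = {j.
     (\<forall>a b g1 g2. g1 \<in> H_half \<Omega> \<longrightarrow> g2 \<in> H_half \<Omega> \<longrightarrow>
        j (\<lambda>x. a * g1 x + b * g2 x) = a * j g1 + b * j g2) \<and>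
     (\<exists>C. \<forall>g\<in>H_half \<Omega>. \<bar>j g\<bar> \<le> C * H_half_norm \<Omega> g)}"

text \<open>Functions are represented on the whole space and set to 0 outside the closure of Omega.\<close>
definition P1 :: "(real^'n) set \<Rightarrow> (real^'n) set set \<Rightarrow> (real^'n \<Rightarrow> real) set" where
  "P1 \<Omega> \<T> = {v. continuous_on (closure \<Omega>) v \<and>
                 (\<forall>T\<in>\<T>. \<exists>a b. \<forall>x\<in>T. v x = a \<bullet> x + b) \<and>
                 (\<forall>x. x \<notin> closure \<Omega> \<longrightarrow> v x = 0)}"

text \<open>Trace of a function continuous up to the boundary: its restriction to the boundary.\<close>
definition trace_on :: "(real^'n) set \<Rightarrow> (real^'n \<Rightarrow> real) \<Rightarrow> (real^'n \<Rightarrow> real)" where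
  "trace_on \<Omega> v = (\<lambda>x. if x \<in> frontier \<Omega> then v x else 0)"

definition P1_diamond :: "(real^'n) set \<Rightarrow> (real^'n) set set \<Rightarrow> (real^'n \<Rightarrow> real) set" where
  "P1_diamond \<Omega> \<T> = {v \<in> P1 \<Omega> \<T>. boundary_integral \<Omega> (trace_on \<Omega> v) = 0}"

definition P1_zero :: "(real^'n) set \<Rightarrow> (real^'n) set set \<Rightarrow> (real^'n \<Rightarrow> real) set" where
  "P1_zero \<Omega> \<T> = {v \<in> P1 \<Omega> \<T>. trace_on \<Omega> v = (\<lambda>x. 0)}"

text \<open>Gradient (for piecewise affine functions it exists a.e. and equals the weak gradient).\<close>
definition grad :: "(real^'n \<Rightarrow> real) \<Rightarrow> real^'n \<Rightarrow> real^'n" where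
  "grad u x = (SOME g. (u has_derivative (\<lambda>y. g \<bullet> y)) (at x))"

definition energy :: "(real^'n) set \<Rightarrow> (real^'n \<Rightarrow> real^'n^'n) \<Rightarrow>
                      (real^'n \<Rightarrow> real) \<Rightarrow> (real^'n \<Rightarrow> real) \<Rightarrow> real" where
  "energy \<Omega> Q u v = integral\<^sup>L (lebesgue_on \<Omega>) (\<lambda>x. (Q x *v grad u x) \<bullet> grad v x)"

definition Neumann_h :: "(real^'n) set \<Rightarrow> (real^'n \<Rightarrow> real^'n^'n) \<Rightarrow> (real^'n) set set \<Rightarrow>
    (real^'n \<Rightarrow> real) \<Rightarrow> ((real^'n \<Rightarrow> real) \<Rightarrow> real) \<Rightarrow> (real^'n \<Rightarrow> real)" where
  "Neumann_h \<Omega> Q \<T> f j = (THE u. u \<in> P1_diamond \<Omega> \<T> \<and>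
      (\<forall>\<phi>\<in>P1_diamond \<Omega> \<T>. energy \<Omega> Q u \<phi> = L2_inner \<Omega> f \<phi> + j (trace_on \<Omega> \<phi>)))"

definition Dirichlet_h :: "(real^'n) set \<Rightarrow> (real^'n \<Rightarrow> real^'n^'n) \<Rightarrow> (real^'n) set set \<Rightarrow>
    (real^'n \<Rightarrow> real) \<Rightarrow> (real^'n \<Rightarrow> real) \<Rightarrow> (real^'n \<Rightarrow> real)" where
  "Dirichlet_h \<Omega> Q \<T> f g = (THE v. v \<in> P1 \<Omega> \<T> \<and> trace_on \<Omega> v = g \<and>
      (\<forall>\<psi>\<in>P1_zero \<Omega> \<T>. energy \<Omega> Q v \<psi> = L2_inner \<Omega> f \<psi>))"

definition J_h :: "(real^'n) set \<Rightarrow> (real^'n \<Rightarrow> real^'n^'n) \<Rightarrow> (real^'n) set set \<Rightarrow>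
    ((real^'n \<Rightarrow> real) \<Rightarrow> real) \<Rightarrow> (real^'n \<Rightarrow> real) \<Rightarrow> (real^'n \<Rightarrow> real) \<Rightarrow> real" where
  "J_h \<Omega> Q \<T> j g f =
     (let w = (\<lambda>x. Neumann_h \<Omega> Q \<T> f j x - Dirichlet_h \<Omega> Q \<T> f g x) in energy \<Omega> Q w w)"

definition Upsilon_h :: "(real^'n) set \<Rightarrow> (real^'n \<Rightarrow> real^'n^'n) \<Rightarrow> (real^'n) set set \<Rightarrow>
    real \<Rightarrow> (real^'n \<Rightarrow> real) \<Rightarrow> ((real^'n \<Rightarrow> real) \<Rightarrow> real) \<Rightarrow> (real^'n \<Rightarrow> real) \<Rightarrow>
    (real^'n \<Rightarrow> real) \<Rightarrow> real" where
  "Upsilon_h \<Omega> Q \<T> \<rho> fstar j g f =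
     J_h \<Omega> Q \<T> j g f + \<rho> * integral\<^sup>L (lebesgue_on \<Omega>) (\<lambda>x. (f x - fstar x)\<^sup>2)"

end

theory Submission
  imports Defs
begin

text \<open>
  The idea for the minimisation: put \<open>S\<close> for the functions of \<open>P1_diamond\<close> that are energy-orthogonal to
  \<open>P1_zero\<close>. For every source \<open>f\<close> the misfit \<open>w f\<close> (discrete Neumann minus discrete Dirichlet
  solution) lies in \<open>S\<close> and is the Riesz representative there of \<open>L2_inner f + l\<close>, where \<open>l\<close> does not
  depend on \<open>f\<close>. Hence the optimality condition \<open>f = fstar - w / \<rho>\<close> is the linear problem
  \<open>energy w \<phi> + L2_inner w \<phi> / \<rho> = L2_inner fstar \<phi> + l \<phi>\<close> on \<open>S\<close>, whose left-hand side is definite, and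
  expanding the quadratic functional at its solution gives
  \<open>\<Upsilon> f' = \<Upsilon> f + energy d d + \<rho> * L2_inner (f' - f) (f' - f)\<close> with \<open>d = w f' - w f\<close>.

  The discrete Neumann problem is well posed because the surface measure of the frontier is finite and
  positive and because traces of \<open>P1\<close> functions, being Lipschitz on the frontier, belong to
  \<open>H_half\<close>: charts show that balls of radius \<open>r\<close> have surface measure \<open>O(r^(d-1))\<close>, which bounds the
  Gagliardo integral by a geometric series over dyadic annuli.
\<close>

section \<open>Hausdorff measure\<close>

text \<open>Several definitions fall back on a default value until a side condition is proved, and
  this shapes the work. \<open>measure_of\<close> gives the zero measure unless its set function is
  countably additive, so nothing is known about the surface measure before Caratheodory's criterion
  is established for \<open>hausdorff_outer\<close>. Non-integrable functions have integral 0, so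
  linearity of \<open>boundary_integral\<close> on traces, and with it the vector space structure of
  \<open>P1_diamond\<close>, comes from finiteness of that measure. Functions of zero energy are
  constants, and positivity of the measure excludes the nonzero ones. The functional
  \<open>j\<close> is linear only on \<open>H_half\<close>, so traces must be placed there before
  the Neumann load is linear. Both discrete operators are definite descriptions, accessible only
  through unique solvability. The form \<open>l\<close> of the overview is
  \<open>j (trace_on \<Omega> \<phi>) - energy \<Omega> Q G \<phi>\<close>, where \<open>G\<close>
  is any \<open>P1\<close> function with trace \<open>g\<close>.\<close>

definition hausdorff_weight :: "real \<Rightarrow> 'a::metric_space set \<Rightarrow> ennreal" where
  "hausdorff_weight s A = ennreal ((pi powr (s / 2) / Gamma (s / 2 + 1)) * (diameter A / 2) powr s)"

definition delta_covers :: "real \<Rightarrow> 'a::metric_space set \<Rightarrow> (nat \<Rightarrow> 'a set) set" where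
  "delta_covers \<delta> A = {C. A \<subseteq> (\<Union>i. C i) \<and> (\<forall>i. bounded (C i) \<and> diameter (C i) \<le> \<delta>)}"

definition hausdorff_pre :: "real \<Rightarrow> real \<Rightarrow> 'a::metric_space set \<Rightarrow> ennreal" where
  "hausdorff_pre s \<delta> A = (INF C \<in> delta_covers \<delta> A. \<Sum>i. hausdorff_weight s (C i))"

lemma hausdorff_outer_eq: "hausdorff_outer s A = (SUP \<delta>\<in>{0<..}. hausdorff_pre s \<delta> A)"
  by (simp add: hausdorff_outer_def hausdorff_pre_def delta_covers_def hausdorff_weight_def)

text \<open>\<open>diameter {} = 0\<close>, and \<open>0 powr s = 0\<close> even for
  \<open>s = 0\<close>, so a cover may be padded with empty sets at no cost.\<close>

lemma hausdorff_weight_empty [simp]: "hausdorff_weight s {} = 0"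
  by (simp add: hausdorff_weight_def)

lemma delta_covers_antimono: "A \<subseteq> B \<Longrightarrow> \<delta> \<le> \<epsilon> \<Longrightarrow> delta_covers \<delta> B \<subseteq> delta_covers \<epsilon> A"
  unfolding delta_covers_def by (auto intro: order_trans)

lemma hausdorff_pre_mono: "A \<subseteq> B \<Longrightarrow> \<delta> \<le> \<epsilon> \<Longrightarrow> hausdorff_pre s \<epsilon> A \<le> hausdorff_pre s \<delta> B"
  unfolding hausdorff_pre_def by (intro INF_superset_mono delta_covers_antimono) auto

lemma hausdorff_pre_le: "C \<in> delta_covers \<delta> A \<Longrightarrow> hausdorff_pre s \<delta> A \<le> (\<Sum>i. hausdorff_weight s (C i))"
  unfolding hausdorff_pre_def by (rule INF_lower)

lemma hausdorff_pre_empty: "\<delta> \<ge> 0 \<Longrightarrow> hausdorff_pre s \<delta> {} = 0"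
  using hausdorff_pre_le[of "\<lambda>_. {}" \<delta> "{}" s] by (simp add: delta_covers_def)

text \<open>Covers of the \<open>A n\<close> that are optimal up to \<open>e * (1/2)^Suc n\<close>
  merge into one cover by way of \<open>prod_decode\<close>, and the errors sum to
  \<open>e\<close>.\<close>

lemma hausdorff_pre_countably_subadditive:
  "hausdorff_pre s \<delta> (\<Union>i::nat. A i) \<le> (\<Sum>i. hausdorff_pre s \<delta> (A i))"
proof (rule ennreal_le_epsilon)
  fix e :: real
  assume e: "0 < e" and fin: "(\<Sum>i. hausdorff_pre s \<delta> (A i)) < top"
  then have "\<And>n. hausdorff_pre s \<delta> (A n) < hausdorff_pre s \<delta> (A n) + e * (1/2)^Suc n"
    by (auto simp add: less_top dest!: ennreal_suminf_lessD)
  then have "\<And>n. \<exists>C\<in>delta_covers \<delta> (A n).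
      (\<Sum>i. hausdorff_weight s (C i)) < hausdorff_pre s \<delta> (A n) + e * (1/2)^Suc n"
    by (subst (asm) (1) hausdorff_pre_def) (simp add: INF_less_iff)
  then obtain C where C: "\<And>n. C n \<in> delta_covers \<delta> (A n)"
    and le: "\<And>n. (\<Sum>i. hausdorff_weight s (C n i)) < hausdorff_pre s \<delta> (A n) + e * (1/2)^Suc n"
    by metis
  define D where "D i = (case prod_decode i of (n, k) \<Rightarrow> C n k)" for i
  have "(\<Union>i. A i) \<subseteq> (\<Union>i. D i)"
  proof
    fix x assume "x \<in> (\<Union>i. A i)"
    then obtain n k where "x \<in> C n k"
      using C unfolding delta_covers_def by blast
    then have "x \<in> D (prod_encode (n, k))" by (simp add: D_def)
    then show "x \<in> (\<Union>i. D i)" by blast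
  qed
  then have "D \<in> delta_covers \<delta> (\<Union>i. A i)"
    using C by (auto simp: delta_covers_def D_def split: prod.split)
  then have "hausdorff_pre s \<delta> (\<Union>i. A i) \<le> (\<Sum>i. hausdorff_weight s (D i))"
    by (rule hausdorff_pre_le)
  also have "\<dots> = (\<Sum>n. \<Sum>k. hausdorff_weight s (C n k))"
    using suminf_ennreal_2dimen[of "\<lambda>n. \<Sum>k. hausdorff_weight s (C n k)" "\<lambda>(n, k). hausdorff_weight s (C n k)"]
    by (simp add: D_def case_prod_unfold)
  also have "\<dots> \<le> (\<Sum>n. hausdorff_pre s \<delta> (A n) + e * (1/2)^Suc n)"
    using le by (intro suminf_le) (auto intro: less_imp_le)
  also have "\<dots> = (\<Sum>n. hausdorff_pre s \<delta> (A n)) + (\<Sum>n. ennreal (e * (1/2)^Suc n))"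
    using e by (subst suminf_add [symmetric]) auto
  also have "(\<Sum>n. ennreal (e * (1/2)^Suc n)) = ennreal e"
  proof -
    have "(\<lambda>n. e * (1/2)^Suc n) sums (e * 1)"
      by (intro sums_mult power_half_series)
    then show ?thesis
      using e by (intro sums_unique[symmetric]) (auto simp: sums_ennreal)
  qed
  finally show "hausdorff_pre s \<delta> (\<Union>i. A i) \<le> (\<Sum>i. hausdorff_pre s \<delta> (A i)) + ennreal e" .
qed

lemma hausdorff_pre_le_outer: "0 < \<delta> \<Longrightarrow> hausdorff_pre s \<delta> A \<le> hausdorff_outer s A"
  unfolding hausdorff_outer_eq by (rule SUP_upper) simp

lemma hausdorff_outer_empty [simp]: "hausdorff_outer s {} = 0"
  unfolding hausdorff_outer_eq by (simp add: hausdorff_pre_empty)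

lemma hausdorff_outer_mono: "A \<subseteq> B \<Longrightarrow> hausdorff_outer s A \<le> hausdorff_outer s B"
  unfolding hausdorff_outer_eq by (intro SUP_mono) (auto intro: hausdorff_pre_mono)

lemma hausdorff_outer_countably_subadditive:
  "hausdorff_outer s (\<Union>i::nat. A i) \<le> (\<Sum>i. hausdorff_outer s (A i))"
  unfolding hausdorff_outer_eq[of s "\<Union>i. A i"]
  by (rule SUP_least, rule order_trans[OF hausdorff_pre_countably_subadditive])
     (intro suminf_le, auto intro: hausdorff_pre_le_outer)

text \<open>A set of diameter at most \<open>\<delta> < \<epsilon>\<close> cannot meet both
  \<open>A\<close> and \<open>B\<close>, so every cover of the union splits into a cover of each
  without spending a set twice.\<close>

lemma hausdorff_pre_metric:
  assumes sep: "\<And>x y. x \<in> A \<Longrightarrow> y \<in> B \<Longrightarrow> \<epsilon> \<le> dist x y" and d: "\<delta> < \<epsilon>" "0 < \<delta>"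
  shows "hausdorff_pre s \<delta> A + hausdorff_pre s \<delta> B \<le> hausdorff_pre s \<delta> (A \<union> B)"
  unfolding hausdorff_pre_def[of s \<delta> "A \<union> B"]
proof (rule INF_greatest)
  fix C assume C: "C \<in> delta_covers \<delta> (A \<union> B)"
  define D where "D X i = (if C i \<inter> X = {} then {} else C i)" for X i
  have cov: "D X \<in> delta_covers \<delta> X" if "X \<subseteq> A \<union> B" for X
    using C that d(2) by (fastforce simp: delta_covers_def D_def)
  have "hausdorff_weight s (D A i) + hausdorff_weight s (D B i) \<le> hausdorff_weight s (C i)" for i
  proof -
    have "C i \<inter> A = {} \<or> C i \<inter> B = {}"
    proof (rule ccontr)
      assume "\<not> ?thesis"
      then obtain x y where xy: "x \<in> C i" "x \<in> A" "y \<in> C i" "y \<in> B" by blast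
      have "bounded (C i)" "diameter (C i) \<le> \<delta>" using C by (auto simp: delta_covers_def)
      then have "dist x y \<le> \<delta>" using diameter_bounded_bound[of "C i" x y] xy by auto
      then show False using sep[OF xy(2,4)] d by simp
    qed
    then show ?thesis by (auto simp: D_def)
  qed
  then have "(\<Sum>i. hausdorff_weight s (D A i) + hausdorff_weight s (D B i)) \<le> (\<Sum>i. hausdorff_weight s (C i))"
    by (intro suminf_le) auto
  then have "(\<Sum>i. hausdorff_weight s (D A i)) + (\<Sum>i. hausdorff_weight s (D B i)) \<le> (\<Sum>i. hausdorff_weight s (C i))"
    by (subst (asm) suminf_add[symmetric]) auto
  moreover have "hausdorff_pre s \<delta> A \<le> (\<Sum>i. hausdorff_weight s (D A i))"
    "hausdorff_pre s \<delta> B \<le> (\<Sum>i. hausdorff_weight s (D B i))"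
    by (intro hausdorff_pre_le cov; blast)+
  ultimately show "hausdorff_pre s \<delta> A + hausdorff_pre s \<delta> B \<le> (\<Sum>i. hausdorff_weight s (C i))"
    by (meson add_mono order_trans)
qed

lemma hausdorff_outer_metric:
  assumes sep: "\<And>x y. x \<in> A \<Longrightarrow> y \<in> B \<Longrightarrow> \<epsilon> \<le> dist x y" and eps: "0 < \<epsilon>"
  shows "hausdorff_outer s A + hausdorff_outer s B \<le> hausdorff_outer s (A \<union> B)"
proof -
  have pre: "hausdorff_pre s \<delta> A + hausdorff_pre s \<eta> B \<le> hausdorff_outer s (A \<union> B)"
    if "0 < \<delta>" "0 < \<eta>" for \<delta> \<eta>
  proof -
    \<comment> \<open>\<open>hausdorff_pre\<close> grows as its scale shrinks, so one scale below
      \<open>\<delta>\<close>, \<open>\<eta>\<close> and \<open>\<epsilon>\<close> serves. Keeping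
      \<open>\<delta>\<close> and \<open>\<eta>\<close> independent lets the two suprema be taken
      one after the other.\<close>
    define \<theta> where "\<theta> = min (min \<delta> \<eta>) (\<epsilon> / 2)"
    have \<theta>: "0 < \<theta>" "\<theta> < \<epsilon>" "\<theta> \<le> \<delta>" "\<theta> \<le> \<eta>" using that eps by (auto simp: \<theta>_def)
    have "hausdorff_pre s \<delta> A + hausdorff_pre s \<eta> B \<le> hausdorff_pre s \<theta> A + hausdorff_pre s \<theta> B"
      using \<theta> by (intro add_mono hausdorff_pre_mono) auto
    also have "\<dots> \<le> hausdorff_pre s \<theta> (A \<union> B)"
      by (rule hausdorff_pre_metric[OF sep]) (use \<theta> in auto)
    also have "\<dots> \<le> hausdorff_outer s (A \<union> B)" using \<theta> by (intro hausdorff_pre_le_outer)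
    finally show ?thesis .
  qed
  have "hausdorff_pre s \<delta> A + hausdorff_outer s B \<le> hausdorff_outer s (A \<union> B)" if "0 < \<delta>" for \<delta>
    unfolding hausdorff_outer_eq[of s B]
    by (subst ennreal_SUP_add_right) (auto intro!: SUP_least pre that)
  then show ?thesis
    unfolding hausdorff_outer_eq[of s A]
    by (subst ennreal_SUP_add_left[symmetric]) (auto intro!: SUP_least)
qed

section \<open>Borel sets and metric outer measures\<close>

lemma suminf_le_even_odd:
  fixes f :: "nat \<Rightarrow> ennreal"
  assumes "\<And>n. (\<Sum>i<n. f (2 * i)) \<le> c" "\<And>n. (\<Sum>i<n. f (2 * i + 1)) \<le> c"
  shows "suminf f \<le> c + c"
proof (rule suminf_le_const)
  fix n
  have "(\<Sum>i<n. f i) \<le> (\<Sum>i<2*n. f i)" by (intro sum_mono2) auto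
  also have "(\<Sum>i<2*n. f i) = (\<Sum>i<n. f (2 * i)) + (\<Sum>i<n. f (2 * i + 1))"
    by (induction n) (auto simp: algebra_simps)
  also have "\<dots> \<le> c + c" using assms by (intro add_mono) auto
  finally show "(\<Sum>i<n. f i) \<le> c + c" .
qed simp

lemma ennreal_suminf_tail:
  fixes f :: "nat \<Rightarrow> ennreal"
  assumes fin: "suminf f < top" and e: "0 < (e::real)"
  shows "\<exists>n. (\<Sum>k. f (k + n)) \<le> ennreal e"
proof -
  define g where "g i = enn2real (f i)" for i
  have "f i \<noteq> top" for i using fin ennreal_suminf_lessD[OF fin] by (simp add: less_top)
  then have fg: "f i = ennreal (g i)" for i by (simp add: g_def less_top)
  have g0: "0 \<le> g i" for i by (simp add: g_def)
  have sg: "summable g" using fin summable_suminf_not_top[of g] g0 by (simp add: fg[abs_def] less_top)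
  obtain n where "norm (\<Sum>k. g (k + n)) < e"
    using suminf_exist_split[OF e sg] by blast
  moreover have "(\<Sum>k. f (k + n)) = ennreal (\<Sum>k. g (k + n))"
    unfolding fg using sg by (intro suminf_ennreal2) (auto simp: g0 summable_iff_shift)
  ultimately show ?thesis by (metis abs_le_D1 ennreal_leI less_imp_le real_norm_def)
qed

text \<open>Alternate rings around \<open>F\<close> are separated, so the series of their measures converges and its tails vanish.\<close>

lemma caratheodory_metric_closed:
  fixes \<mu> :: "'a::metric_space set \<Rightarrow> ennreal"
  assumes empty: "\<mu> {} = 0" and mono: "\<And>A B. A \<subseteq> B \<Longrightarrow> \<mu> A \<le> \<mu> B"
    and subadd: "\<And>A :: nat \<Rightarrow> 'a set. \<mu> (\<Union>i. A i) \<le> (\<Sum>i. \<mu> (A i))"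
    and metric: "\<And>A B \<epsilon>. 0 < \<epsilon> \<Longrightarrow> (\<And>x y. x \<in> A \<Longrightarrow> y \<in> B \<Longrightarrow> \<epsilon> \<le> dist x y) \<Longrightarrow> \<mu> A + \<mu> B \<le> \<mu> (A \<union> B)"
    and F: "closed F"
  shows "\<mu> (A \<inter> F) + \<mu> (A - F) \<le> \<mu> A"
proof (cases "F = {}")
  case True
  then show ?thesis by (simp add: empty)
next
  case Fne: False
  define d where "d x = infdist x F" for x
  have d_lip: "d x \<le> d y + dist x y" for x y unfolding d_def by (rule infdist_triangle)
  have d_F: "d x = 0" if "x \<in> F" for x using that by (simp add: d_def)
  have d_pos: "0 < d x" if "x \<notin> F" for x
    using that F Fne by (metis d_def in_closed_iff_infdist_zero infdist_nonneg less_eq_real_def)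
  define Far where "Far n = {x \<in> A. 1 / real (n + 1) \<le> d x}" for n
  define Ring where "Ring n = {x \<in> A. 1 / real (n + 2) \<le> d x \<and> d x < 1 / real (n + 1)}" for n
  have split: "A - F \<subseteq> Far n \<union> (\<Union>k. Ring (k + n))" for n
  proof
    fix x assume x: "x \<in> A - F"
    show "x \<in> Far n \<union> (\<Union>k. Ring (k + n))"
    proof (cases "x \<in> Far n")
      case False
      then have lt: "d x < 1 / real (n + 1)" using x by (auto simp: Far_def)
      \<comment> \<open>Such a \<open>j\<close> exists because \<open>F\<close> is closed and hence
        \<open>d x > 0\<close>. The least one exceeds \<open>n\<close>, and minimality puts
        \<open>x\<close> into \<open>Ring (j - 1)\<close>.\<close>
      define j where "j = (LEAST j. 1 / real (j + 1) \<le> d x)"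
      obtain j0 where "1 / real (Suc j0) < d x"
        using d_pos x nat_approx_posE by blast
      then have ex: "1 / real (j0 + 1) \<le> d x" by simp
      then have j: "1 / real (j + 1) \<le> d x" unfolding j_def by (rule LeastI)
      have "n < j"
      proof (rule ccontr)
        assume "\<not> n < j"
        then have "1 / real (n + 1) \<le> 1 / real (j + 1)" by (simp add: frac_le)
        then show False using j lt by linarith
      qed
      then obtain i where i: "j = i + 1" "n \<le> i" by (metis Suc_eq_plus1 less_Suc_eq_le not0_implies_Suc not_less0)
      then have "\<not> 1 / real (i + 1) \<le> d x" using not_less_Least[of i "\<lambda>j. 1 / real (j + 1) \<le> d x"] j_def by simp
      then have "x \<in> Ring ((i - n) + n)" using x j i by (simp add: Ring_def)
      then show ?thesis by blast
    qed simp
  qed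
  \<comment> \<open>\<open>d\<close> is 1-Lipschitz, so a gap between values of \<open>d\<close> is
    a gap between points.\<close>
  have sepR: "\<mu> (Ring k \<union> B) \<ge> \<mu> (Ring k) + \<mu> B" if "\<And>y. y \<in> B \<Longrightarrow> d y < 1 / real (k + 3)" for k B
  proof (rule metric)
    have "1 / real (k + 3) < 1 / real (k + 2)" by (rule divide_strict_left_mono) auto
    then show "0 < 1 / real (k + 2) - 1 / real (k + 3)" by simp
    show "1 / real (k + 2) - 1 / real (k + 3) \<le> dist x y" if "x \<in> Ring k" "y \<in> B" for x y
      using that \<open>\<And>y. y \<in> B \<Longrightarrow> _\<close>[of y] d_lip[of x y] by (auto simp: Ring_def)
  qed
  have chain: "(\<Sum>i<n. \<mu> (Ring (2 * i + p))) \<le> \<mu> A" for n p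
  proof -
    \<comment> \<open>The starting index is general so that the outermost ring can be peeled off.
      The remaining rings have index at least two higher, which leaves the gap that
      \<open>sepR\<close> requires.\<close>
    have "(\<Sum>i\<in>{j..<j+n}. \<mu> (Ring (2 * i + p))) \<le> \<mu> (\<Union>i\<in>{j..<j+n}. Ring (2 * i + p))" for j
    proof (induction n arbitrary: j)
      case (Suc n)
      let ?B = "\<Union>i\<in>{Suc j..<Suc j+n}. Ring (2 * i + p)"
      have eq: "{j..<j + Suc n} = insert j {Suc j..<Suc j+n}" by auto
      have "d y < 1 / real (2 * j + p + 3)" if "y \<in> ?B" for y
      proof -
        from that obtain i where "Suc j \<le> i" "y \<in> Ring (2 * i + p)" by auto
        then have "d y < 1 / real (2 * i + p + 1)" by (simp add: Ring_def)
        also have "\<dots> \<le> 1 / real (2 * j + p + 3)" using \<open>Suc j \<le> i\<close> by (intro frac_le) auto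
        finally show ?thesis .
      qed
      then have "\<mu> (Ring (2 * j + p)) + \<mu> ?B \<le> \<mu> (Ring (2 * j + p) \<union> ?B)" by (rule sepR)
      then have "\<mu> (Ring (2 * j + p)) + (\<Sum>i\<in>{Suc j..<Suc j+n}. \<mu> (Ring (2 * i + p))) \<le> \<mu> (Ring (2 * j + p) \<union> ?B)"
        using Suc[of "Suc j"] by (meson add_left_mono order_trans)
      then show ?case unfolding eq by simp
    qed (simp add: empty)
    from this[of 0] have "(\<Sum>i<n. \<mu> (Ring (2 * i + p))) \<le> \<mu> (\<Union>i\<in>{0..<n}. Ring (2 * i + p))"
      by (simp add: atLeast0LessThan)
    also have "\<dots> \<le> \<mu> A" by (rule mono) (auto simp: Ring_def)
    finally show ?thesis .
  qed
  show ?thesis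
  proof (rule ennreal_le_epsilon)
    fix e :: real assume fin: "\<mu> A < top" and e: "0 < e"
    have "(\<Sum>i. \<mu> (Ring i)) \<le> \<mu> A + \<mu> A"
    proof (rule suminf_le_even_odd)
      show "(\<Sum>i<n. \<mu> (Ring (2 * i))) \<le> \<mu> A" for n using chain[where n=n and p=0] by simp
      show "(\<Sum>i<n. \<mu> (Ring (2 * i + 1))) \<le> \<mu> A" for n using chain[where n=n and p=1] by simp
    qed
    also have "\<dots> < top" using fin by (simp add: less_top)
    finally obtain n where n: "(\<Sum>k. \<mu> (Ring (k + n))) \<le> ennreal e"
      using ennreal_suminf_tail[of "\<lambda>i. \<mu> (Ring i)"] e by blast
    define B where "B i = (case i of 0 \<Rightarrow> Far n | Suc k \<Rightarrow> Ring (k + n))" for i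
    have "\<mu> (A - F) \<le> \<mu> (\<Union>i. B i)"
    proof (rule mono, rule order_trans[OF split[of n]])
      show "Far n \<union> (\<Union>k. Ring (k + n)) \<subseteq> (\<Union>i. B i)"
      proof safe
        fix x assume "x \<in> Far n"
        then have "x \<in> B 0" by (simp add: B_def)
        then show "x \<in> (\<Union>i. B i)" by blast
      next
        fix x k assume "x \<in> Ring (k + n)"
        then have "x \<in> B (Suc k)" by (simp add: B_def)
        then show "x \<in> (\<Union>i. B i)" by blast
      qed
    qed
    also have "\<dots> \<le> (\<Sum>i. \<mu> (B i))" by (rule subadd)
    also have "\<dots> = \<mu> (B 0) + (\<Sum>i. \<mu> (B (Suc i)))" by (subst suminf_offset[where i=1]) auto
    also have "\<dots> \<le> \<mu> (Far n) + ennreal e" using n by (intro add_mono) (auto simp: B_def)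
    finally have "\<mu> (A \<inter> F) + \<mu> (A - F) \<le> (\<mu> (A \<inter> F) + \<mu> (Far n)) + ennreal e"
      by (simp add: add.assoc add_left_mono)
    \<comment> \<open>\<open>Far n\<close> keeps distance \<open>1 / (n + 1)\<close> from
      \<open>F\<close>, so these two pieces add without loss; the rings in between cost only
      \<open>e\<close>.\<close>
    also have "\<mu> (A \<inter> F) + \<mu> (Far n) \<le> \<mu> (A \<inter> F \<union> Far n)"
    proof (rule metric)
      show "0 < 1 / real (n + 1)" by simp
      show "1 / real (n + 1) \<le> dist x y" if "x \<in> A \<inter> F" "y \<in> Far n" for x y
        using that d_lip[of y x] d_F[of x] by (auto simp: Far_def dist_commute)
    qed
    also have "\<mu> (A \<inter> F \<union> Far n) \<le> \<mu> A" by (rule mono) (auto simp: Far_def)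
    finally show "\<mu> (A \<inter> F) + \<mu> (A - F) \<le> \<mu> A + ennreal e" by (simp add: add_right_mono)
  qed
qed

lemma hausdorff_outer_Un: "hausdorff_outer s (A \<union> B) \<le> hausdorff_outer s A + hausdorff_outer s B"
proof -
  have eq: "(\<Union>i::nat. if i = 0 then A else if i = 1 then B else {}) = A \<union> B"
    by (auto split: if_splits)
  have "hausdorff_outer s (\<Union>i::nat. if i = 0 then A else if i = 1 then B else {})
      \<le> (\<Sum>i::nat. hausdorff_outer s (if i = 0 then A else if i = 1 then B else {}))"
    by (rule hausdorff_outer_countably_subadditive)
  also have "\<dots> = (\<Sum>i\<in>{0, 1::nat}. hausdorff_outer s (if i = 0 then A else if i = 1 then B else {}))"
    by (rule suminf_finite) auto
  finally show ?thesis unfolding eq by simp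
qed

text \<open>Caratheodory's construction: \<open>hausdorff_outer\<close> is a measure on its
  \<open>lambda_system\<close>. This contains every closed set by
  \<open>caratheodory_metric_closed\<close> and therefore, being a sigma-algebra, all Borel
  sets.\<close>

lemma measure_space_hausdorff_outer:
  "measure_space UNIV (sets borel) (hausdorff_outer s :: 'a::metric_space set \<Rightarrow> ennreal)"
proof -
  let ?H = "hausdorff_outer s :: 'a set \<Rightarrow> ennreal"
  interpret P: sigma_algebra UNIV "Pow UNIV :: 'a set set" by (rule sigma_algebra_Pow)
  have "countably_subadditive (Pow UNIV) ?H"
    unfolding countably_subadditive_def using hausdorff_outer_countably_subadditive by blast
  then have oms: "outer_measure_space (Pow UNIV) ?H"
    by (auto simp: outer_measure_space_def positive_def increasing_def hausdorff_outer_mono)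
  have ms: "measure_space UNIV (lambda_system UNIV (Pow UNIV) ?H) ?H"
    by (rule P.caratheodory_lemma[OF oms])
  then interpret L: sigma_algebra UNIV "lambda_system UNIV (Pow UNIV) ?H"
    by (simp add: measure_space_def)
  have closed: "F \<in> lambda_system UNIV (Pow UNIV) ?H" if "closed F" for F :: "'a set"
  proof -
    have "?H (A \<inter> F) + ?H (A - F) = ?H A" for A
    proof (rule antisym)
      show "?H (A \<inter> F) + ?H (A - F) \<le> ?H A"
        using that by (intro caratheodory_metric_closed hausdorff_outer_mono
            hausdorff_outer_countably_subadditive hausdorff_outer_metric) auto
      show "?H A \<le> ?H (A \<inter> F) + ?H (A - F)"
        using hausdorff_outer_Un[of s "A \<inter> F" "A - F"] by (simp add: Int_Diff_Un)
    qed
    then show ?thesis unfolding P.lambda_system_eq by auto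
  qed
  have "sigma_sets UNIV (Collect closed) \<subseteq> lambda_system UNIV (Pow UNIV) ?H"
    using closed by (intro L.sigma_sets_subset) blast
  then have sub: "sets borel \<subseteq> lambda_system UNIV (Pow UNIV) ?H"
    by (subst borel_eq_closed) simp
  have "sigma_algebra UNIV (sets borel :: 'a set set)"
    using sets.sigma_algebra_axioms[of "borel :: 'a measure"] by simp
  with ms sub show ?thesis
    by (auto simp: measure_space_def positive_def countably_additive_def)
qed

section \<open>Surface measure as restricted Hausdorff measure\<close>

lemma space_surface_measure [simp]: "space (surface_measure \<Omega>) = frontier \<Omega>"
  unfolding surface_measure_def
  by (subst space_measure_of) (auto simp: sets_restrict_space)

lemma sets_surface_measure [measurable_cong]: "sets (surface_measure \<Omega>) = sets (restrict_space borel (frontier \<Omega>))"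
proof -
  have "sets (surface_measure \<Omega>) = sigma_sets (frontier \<Omega>) (sets (restrict_space borel (frontier \<Omega>)))"
    unfolding surface_measure_def by (subst sets_measure_of) (auto simp: sets_restrict_space)
  also have "\<dots> = sets (restrict_space borel (frontier \<Omega>))"
    using sets.sigma_sets_eq[of "restrict_space borel (frontier \<Omega>)"] by simp
  finally show ?thesis .
qed

text \<open>Countable additivity on Borel sets passes the test inside \<open>measure_of\<close>; the
  frontier is closed, so the sets of the restricted algebra are Borel.\<close>

lemma emeasure_surface_measure:
  fixes \<Omega> :: "(real^'n) set"
  assumes A: "A \<in> sets (surface_measure \<Omega>)"
  shows "emeasure (surface_measure \<Omega>) A = hausdorff_outer (real CARD('n) - 1) A"
  unfolding surface_measure_def
proof (rule emeasure_measure_of_sigma)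
  let ?H = "hausdorff_outer (real CARD('n) - 1) :: (real^'n) set \<Rightarrow> ennreal"
  let ?M = "restrict_space borel (frontier \<Omega>)"
  show "sigma_algebra (frontier \<Omega>) (sets ?M)"
    using sets.sigma_algebra_axioms[of ?M] by simp
  show "positive (sets ?M) ?H" by (simp add: positive_def)
  have sub: "sets ?M \<subseteq> sets borel"
    by (auto simp: sets_restrict_space)
  show "countably_additive (sets ?M) ?H"
    using measure_space_hausdorff_outer[of "real CARD('n) - 1", where 'a="real^'n"] sub
    unfolding measure_space_def countably_additive_def by blast
  show "A \<in> sets ?M" using A by (simp add: sets_surface_measure)
qed

section \<open>Upper and lower bounds for Hausdorff measure\<close>

lemma hausdorff_pre_finite_cover:
  assumes I: "finite I" and cov: "A \<subseteq> (\<Union>i\<in>I. C i)" and \<delta>: "0 \<le> \<delta>"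
    and C: "\<And>i. i \<in> I \<Longrightarrow> bounded (C i)" "\<And>i. i \<in> I \<Longrightarrow> diameter (C i) \<le> \<delta>"
  shows "hausdorff_pre s \<delta> A \<le> (\<Sum>i\<in>I. hausdorff_weight s (C i))"
proof -
  obtain h where h: "bij_betw h {0..<card I} I" using ex_bij_betw_nat_finite[OF I] by blast
  define D where "D n = (if n < card I then C (h n) else {})" for n
  have hI: "h n \<in> I" if "n < card I" for n using h that by (auto simp: bij_betw_def)
  have "A \<subseteq> (\<Union>n. D n)"
  proof
    fix x assume "x \<in> A"
    then obtain i where "i \<in> I" "x \<in> C i" using cov by blast
    moreover from h \<open>i \<in> I\<close> have "i \<in> h ` {0..<card I}" by (simp add: bij_betw_def)
    ultimately obtain n where "n < card I" "x \<in> C (h n)" by auto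
    then have "x \<in> D n" by (simp add: D_def)
    then show "x \<in> (\<Union>n. D n)" by blast
  qed
  then have "D \<in> delta_covers \<delta> A"
    using C hI \<delta> by (auto simp: delta_covers_def D_def)
  then have "hausdorff_pre s \<delta> A \<le> (\<Sum>n. hausdorff_weight s (D n))" by (rule hausdorff_pre_le)
  also have "\<dots> = (\<Sum>n\<in>{0..<card I}. hausdorff_weight s (D n))"
    by (rule suminf_finite) (auto simp: D_def)
  also have "\<dots> = (\<Sum>n\<in>{0..<card I}. hausdorff_weight s (C (h n)))"
    by (rule sum.cong) (auto simp: D_def)
  also have "\<dots> = (\<Sum>i\<in>I. hausdorff_weight s (C i))"
    by (rule sum.reindex_bij_betw[OF h])
  finally show ?thesis .
qed

text \<open>The normalising factor of \<open>hausdorff_weight\<close>; for integer \<open>s\<close>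
  it is the volume of the s-dimensional unit ball.\<close>

lemma hausdorff_constant_pos: "0 \<le> s \<Longrightarrow> 0 < pi powr (s / 2) / Gamma (s / 2 + 1 :: real)"
  by (simp add: Gamma_real_pos)

text \<open>A grid argument: the \<open>m\<close> coordinates are cut into steps of length
  \<open>D / N\<close>, which gives \<open>(2 * N + 1) ^ m\<close> cells of diameter at most
  \<open>M * m * D / N\<close>. The total weight stays bounded as \<open>N\<close> grows because the
  powers of \<open>N\<close> cancel.\<close>

lemma hausdorff_outer_bilipschitz_coordinates:
  fixes p :: "'i \<Rightarrow> 'a::real_normed_vector \<Rightarrow> real"
  assumes K: "finite K" "card K = m" "0 < m" and D: "0 < D" and M: "0 < M"
    and p: "\<And>i y z. i \<in> K \<Longrightarrow> y \<in> A \<Longrightarrow> z \<in> A \<Longrightarrow> \<bar>p i y - p i z\<bar> \<le> D"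
    and inv: "\<And>y z. y \<in> A \<Longrightarrow> z \<in> A \<Longrightarrow> dist y z \<le> M * (\<Sum>i\<in>K. \<bar>p i y - p i z\<bar>)"
  shows "hausdorff_outer m A \<le> ennreal ((pi powr (m / 2) / Gamma (m / 2 + 1)) * (3 * M * m / 2) ^ m * D ^ m)"
proof (cases "A = {}")
  case False
  then obtain a where a: "a \<in> A" by blast
  define c where "c = pi powr (real m / 2) / Gamma (real m / 2 + 1)"
  have c: "0 < c" unfolding c_def by (rule hausdorff_constant_pos) simp
  have "hausdorff_pre m \<delta> A \<le> ennreal (c * (3 * M * m / 2) ^ m * D ^ m)" if \<delta>: "0 < \<delta>" for \<delta>
  proof -
    \<comment> \<open>Large enough for the cells to be admissible at scale \<open>\<delta>\<close>;
      \<open>Suc\<close> keeps \<open>N\<close> positive.\<close>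
    obtain N0 :: nat where N0: "M * m * D / \<delta> < N0" using reals_Archimedean2 by blast
    define N where "N = Suc N0"
    have N: "0 < N" by (simp add: N_def)
    have small: "M * m * D / N \<le> \<delta>" using N0 \<delta> by (simp add: N_def field_simps)
    define I where "I = K \<rightarrow>\<^sub>E {- int N..int N}"
    \<comment> \<open>Measured from the base point \<open>a\<close>, the floors lie between
      \<open>- N\<close> and \<open>N\<close>, whence \<open>2 * N + 1\<close> steps per
      coordinate.\<close>
    define C where "C n = {y \<in> A. \<forall>i\<in>K. \<lfloor>(p i y - p i a) * N / D\<rfloor> = n i}" for n
    have finI: "finite I" unfolding I_def by (intro finite_PiE K) auto
    have cardI: "card I = (2 * N + 1) ^ m"
      unfolding I_def using K by (simp add: card_PiE nat_add_distrib nat_mult_distrib)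
    have cov: "A \<subseteq> (\<Union>n\<in>I. C n)"
    proof
      fix y assume y: "y \<in> A"
      define n where "n = restrict (\<lambda>i. \<lfloor>(p i y - p i a) * N / D\<rfloor>) K"
      have "\<lfloor>(p i y - p i a) * N / D\<rfloor> \<in> {- int N..int N}" if i: "i \<in> K" for i
      proof -
        have "\<bar>(p i y - p i a) * N / D\<bar> \<le> N"
          using mult_right_mono[OF p[OF i y a], of "real N"] D by (simp add: abs_mult pos_divide_le_eq mult.commute)
        then have "(p i y - p i a) * N / D \<le> N" "- real N \<le> (p i y - p i a) * N / D" by linarith+
        then show ?thesis by (auto simp: le_floor_iff floor_le_iff)
      qed
      then have "n \<in> I" by (auto simp: n_def I_def)
      moreover have "y \<in> C n" using y by (simp add: C_def n_def)
      ultimately show "y \<in> (\<Union>n\<in>I. C n)" by blast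
    qed
    have dist: "dist y z \<le> M * m * D / N" if y: "y \<in> C n" and z: "z \<in> C n" for y z n
    proof -
      have "\<bar>p i y - p i z\<bar> \<le> D / N" if i: "i \<in> K" for i
      proof -
        have "\<lfloor>(p i y - p i a) * N / D\<rfloor> = \<lfloor>(p i z - p i a) * N / D\<rfloor>"
          using y z i by (simp add: C_def)
        then have "\<bar>(p i y - p i a) * N / D - (p i z - p i a) * N / D\<bar> \<le> 1" by linarith
        then have "\<bar>(p i y - p i z) * N / D\<bar> \<le> 1" by (simp add: algebra_simps diff_divide_distrib)
        then show ?thesis using D N by (simp add: abs_mult pos_divide_le_eq pos_le_divide_eq)
      qed
      then have "(\<Sum>i\<in>K. \<bar>p i y - p i z\<bar>) \<le> m * (D / N)"
        using sum_bounded_above[of K "\<lambda>i. \<bar>p i y - p i z\<bar>" "D / N"] K by simp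
      then have "M * (\<Sum>i\<in>K. \<bar>p i y - p i z\<bar>) \<le> M * (m * (D / N))"
        by (rule mult_left_mono) (use M in simp)
      then show ?thesis using inv[of y z] y z by (simp add: C_def)
    qed
    have pos: "0 \<le> M * m * D / N" using M D by simp
    have diam: "diameter (C n) \<le> M * m * D / N" for n
      using dist pos by (intro diameter_le) (auto simp: dist_norm)
    have bdd: "bounded (C n)" for n
      unfolding bounded_two_points using dist by blast
    have weight: "hausdorff_weight m (C n) \<le> ennreal (c * (M * m * D / (2 * N)) ^ m)" for n
    proof -
      have "(diameter (C n) / 2) powr m \<le> (M * m * D / N / 2) powr m"
        using diam[of n] diameter_ge_0[OF bdd[of n]] by (intro powr_mono2) auto
      also have "\<dots> = (M * m * D / (2 * N)) ^ m"
        using M D N K by (subst powr_realpow) (auto simp: mult.commute)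
      finally show ?thesis
        unfolding hausdorff_weight_def c_def[symmetric] using c by (intro ennreal_leI mult_left_mono) auto
    qed
    have "hausdorff_pre m \<delta> A \<le> (\<Sum>n\<in>I. hausdorff_weight m (C n))"
      using diam small \<delta> by (intro hausdorff_pre_finite_cover finI cov bdd) (auto intro: order_trans)
    also have "\<dots> \<le> (\<Sum>n\<in>I. ennreal (c * (M * m * D / (2 * N)) ^ m))"
      by (intro sum_mono weight)
    also have "\<dots> = ennreal ((2 * N + 1) ^ m * (c * (M * m * D / (2 * N)) ^ m))"
      using c M D by (simp add: cardI ennreal_of_nat_eq_real_of_nat ennreal_mult'' add_ac)
    also have "\<dots> \<le> ennreal (c * (3 * M * m / 2) ^ m * D ^ m)"
    proof (rule ennreal_leI)
      \<comment> \<open>The factor 3 of the constant comes from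
        \<open>2 * N + 1 \<le> 3 * N\<close>.\<close>
      have "real (2 * N + 1) ^ m \<le> (3 * real N) ^ m" using N by (intro power_mono) auto
      then have "real (2 * N + 1) ^ m * (c * (M * m * D / (2 * N)) ^ m) \<le> (3 * real N) ^ m * (c * (M * m * D / (2 * N)) ^ m)"
        using c M D by (intro mult_right_mono) auto
      also have "\<dots> = c * (3 * real N * (M * m * D / (2 * N))) ^ m"
        by (subst power_mult_distrib) (simp only: mult_ac)
      also have "3 * real N * (M * m * D / (2 * N)) = (3 * M * m / 2) * D" using N by simp
      finally show "real ((2 * N + 1) ^ m) * (c * (M * m * D / (2 * N)) ^ m) \<le> c * (3 * M * m / 2) ^ m * D ^ m"
        by (simp only: power_mult_distrib[of _ D] mult.assoc of_nat_power)
    qed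
    finally show ?thesis .
  qed
  then show ?thesis unfolding hausdorff_outer_eq c_def by (intro SUP_least) simp
qed simp

text \<open>Every line through a cube in \<open>U\<close> parallel to a fixed axis meets the frontier, so the projections of the
  sets of a cover, extended along that axis, must fill the volume of the cube.\<close>

lemma hausdorff_outer_frontier_pos:
  fixes U :: "(real^'n) set"
  assumes U: "open U" "bounded U" "U \<noteq> {}" and n: "2 \<le> CARD('n)"
  shows "0 < hausdorff_outer (real CARD('n) - 1) (frontier U)"
proof -
  define m where "m = CARD('n) - 1"
  have m: "real CARD('n) - 1 = real m" "0 < m" "CARD('n) = Suc m" using n by (auto simp: m_def)
  fix k :: 'n
  obtain x0 where "x0 \<in> U" using U by blast
  then obtain a b where ab: "cbox a b \<subseteq> U" "x0 \<in> box a b"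
    using open_contains_cbox[of U] U by metis
  have lt: "a $ i < b $ i" for i using ab by (auto simp: mem_box_cart intro: less_trans)
  define c where "c = pi powr (real m / 2) / Gamma (real m / 2 + 1)"
  have c: "0 < c" unfolding c_def by (rule hausdorff_constant_pos) simp
  define V where "V = (\<Prod>i\<in>UNIV. b $ i - a $ i)"
  have V: "0 < V" unfolding V_def by (intro prod_pos) (simp add: lt)
  \<comment> \<open>The box built around a covering set has volume
    \<open>(b $ k - a $ k) * (2 * diameter) ^ m\<close>. Writing \<open>2 * diameter\<close> as
    \<open>4 * (diameter / 2)\<close> turns this into \<open>q\<close> times the weight of the
    set.\<close>
  define q where "q = (b $ k - a $ k) * 4 ^ m / c"
  have q: "0 < q" using lt c by (simp add: q_def)
  have emV: "emeasure lborel (cbox a b) = ennreal V"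
    using lt by (subst emeasure_eq_ennreal_measure)
      (auto simp: V_def content_cbox_cart interval_ne_empty_cart less_imp_le emeasure_lborel_cbox_eq)
  \<comment> \<open>The line through \<open>z\<close> meets \<open>U\<close> and, as
    \<open>U\<close> is bounded, also leaves it; connectedness does the rest.\<close>
  have ray: "\<exists>x\<in>frontier U. \<forall>i. i \<noteq> k \<longrightarrow> x $ i = z $ i" if z: "z \<in> cbox a b" for z
  proof -
    let ?L = "range (\<lambda>t::real. z + t *\<^sub>R axis k 1)"
    obtain B where B: "\<And>x. x \<in> U \<Longrightarrow> norm x \<le> B" using U by (auto simp: bounded_iff)
    have "connected ?L"
      by (intro connected_continuous_image continuous_intros connected_UNIV)
    moreover have "?L \<inter> U \<noteq> {}"
      using z ab(1) by (auto intro!: exI[of _ z] image_eqI[where x=0])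
    moreover have "?L - U \<noteq> {}"
    proof -
      define t where "t = norm z + \<bar>B\<bar> + 1"
      have "norm (t *\<^sub>R axis k 1 :: real^'n) = \<bar>t\<bar>" by (simp add: norm_axis_1)
      then have "norm (z + t *\<^sub>R axis k 1) \<ge> \<bar>t\<bar> - norm z"
        by (metis add.commute norm_diff_ineq)
      then have "norm (z + t *\<^sub>R axis k 1) > B" by (simp add: t_def)
      then have "z + t *\<^sub>R axis k 1 \<notin> U" using B by fastforce
      then show ?thesis by blast
    qed
    ultimately have "?L \<inter> frontier U \<noteq> {}" by (rule connected_Int_frontier)
    then obtain t where "z + t *\<^sub>R axis k 1 \<in> frontier U" by blast
    then show ?thesis by (intro bexI) (auto simp: axis_def)
  qed
  have "ennreal V \<le> ennreal q * (\<Sum>i. hausdorff_weight m (C i))"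
    if C: "C \<in> delta_covers 1 (frontier U)" for C
  proof -
    have bdd: "bounded (C i)" for i using C by (simp add: delta_covers_def)
    \<comment> \<open>For empty \<open>C i\<close> the point is arbitrary; the box is then flat and
      has volume 0, in agreement with the weight.\<close>
    define pt where "pt i = (SOME x. x \<in> C i)" for i
    have pt: "pt i \<in> C i" if "C i \<noteq> {}" for i using that by (auto simp: pt_def intro: someI)
    define lo where "lo i = (\<chi> j. if j = k then a $ k else pt i $ j - diameter (C i))" for i
    define hi where "hi i = (\<chi> j. if j = k then b $ k else pt i $ j + diameter (C i))" for i
    have d0: "0 \<le> diameter (C i)" for i by (rule diameter_ge_0[OF bdd])
    have sub: "cbox a b \<subseteq> (\<Union>i. cbox (lo i) (hi i))"
    proof
      fix z assume z: "z \<in> cbox a b"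
      then obtain x where x: "x \<in> frontier U" "\<And>i. i \<noteq> k \<Longrightarrow> x $ i = z $ i" using ray by blast
      then obtain i where i: "x \<in> C i" using C by (auto simp: delta_covers_def)
      have near: "\<bar>x $ j - pt i $ j\<bar> \<le> diameter (C i)" for j
      proof -
        have "\<bar>x $ j - pt i $ j\<bar> \<le> dist x (pt i)" using component_le_norm_cart[of "x - pt i" j] by (simp add: dist_norm)
        also have "\<dots> \<le> diameter (C i)" using i by (intro diameter_bounded_bound bdd pt) auto
        finally show ?thesis .
      qed
      have "lo i $ j \<le> z $ j \<and> z $ j \<le> hi i $ j" for j
      proof (cases "j = k")
        case True
        then show ?thesis using z by (simp add: mem_box_cart lo_def hi_def)
      next
        case False
        have "\<bar>z $ j - pt i $ j\<bar> \<le> diameter (C i)"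
          using near[of j] x(2)[OF False] by simp
        with False show ?thesis by (auto simp: lo_def hi_def abs_le_iff)
      qed
      then have "z \<in> cbox (lo i) (hi i)" by (simp add: mem_box_cart)
      then show "z \<in> (\<Union>i. cbox (lo i) (hi i))" by blast
    qed
    have em: "emeasure lborel (cbox (lo i) (hi i)) = ennreal q * hausdorff_weight m (C i)" for i
    proof -
      have le: "lo i $ j \<le> hi i $ j" for j
        using d0[of i] lt[of k] by (auto simp: lo_def hi_def)
      have "emeasure lborel (cbox (lo i) (hi i)) = ennreal (\<Prod>j\<in>UNIV. hi i $ j - lo i $ j)"
        using le by (subst emeasure_eq_ennreal_measure)
          (auto simp: content_cbox_cart interval_ne_empty_cart emeasure_lborel_cbox_eq)
      also have "(\<Prod>j\<in>UNIV. hi i $ j - lo i $ j) = (hi i $ k - lo i $ k) * (\<Prod>j\<in>UNIV - {k}. hi i $ j - lo i $ j)"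
        by (rule prod.remove) auto
      also have "(\<Prod>j\<in>UNIV - {k}. hi i $ j - lo i $ j) = (\<Prod>j\<in>UNIV - {k}. 2 * diameter (C i))"
        by (rule prod.cong) (auto simp: lo_def hi_def)
      also have "\<dots> = (2 * diameter (C i)) ^ m" by (simp add: m_def)
      also have "hi i $ k - lo i $ k = b $ k - a $ k" by (simp add: lo_def hi_def)
      also have "(2 * diameter (C i)) ^ m = 4 ^ m * (diameter (C i) / 2) ^ m"
        by (subst power_mult_distrib[symmetric]) simp
      also have "(diameter (C i) / 2) ^ m = (diameter (C i) / 2) powr m"
        using d0[of i] m(2) by (cases "diameter (C i) = 0") (auto simp: powr_realpow)
      finally show ?thesis
        unfolding hausdorff_weight_def c_def[symmetric] using c q by (simp add: ennreal_mult''[symmetric] q_def)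
    qed
    have "ennreal V = emeasure lborel (cbox a b)" by (simp add: emV)
    also have "\<dots> \<le> emeasure lborel (\<Union>i. cbox (lo i) (hi i))" by (rule emeasure_mono[OF sub]) auto
    also have "\<dots> \<le> (\<Sum>i. emeasure lborel (cbox (lo i) (hi i)))"
      by (rule emeasure_subadditive_countably) auto
    also have "\<dots> = ennreal q * (\<Sum>i. hausdorff_weight m (C i))" by (simp add: em)
    finally show ?thesis .
  qed
  note V_le = this
  have "ennreal (V / q) \<le> (\<Sum>i. hausdorff_weight m (C i))" if "C \<in> delta_covers 1 (frontier U)" for C
  proof (cases "\<Sum>i. hausdorff_weight m (C i)")
    case (real r)
    have "ennreal V \<le> ennreal (q * r)"
      using V_le[OF that] real q by (simp add: ennreal_mult)
    then have "V \<le> q * r" using real q by (simp add: ennreal_le_iff)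
    then show ?thesis using real q by (simp add: field_simps)
  qed simp
  then have "ennreal (V / q) \<le> hausdorff_pre m 1 (frontier U)"
    unfolding hausdorff_pre_def by (intro INF_greatest)
  also have "\<dots> \<le> hausdorff_outer m (frontier U)" by (rule hausdorff_pre_le_outer) simp
  finally show ?thesis using V q unfolding m(1) by (meson divide_pos_pos ennreal_less_zero_iff order_less_le_trans)
qed

section \<open>Surface measure of a Lipschitz boundary\<close>

lemma ennreal_le_suminf: "f k \<le> suminf f" for f :: "nat \<Rightarrow> ennreal"
  using sum_le_suminf[of f "{k}"] by simp

locale lipschitz_domain =
  fixes \<Omega> :: "(real^'n) set"
  assumes open_dom: "open \<Omega>" and bounded_dom: "bounded \<Omega>" and nonempty_dom: "\<Omega> \<noteq> {}"
    and lipschitz_dom: "lipschitz_boundary \<Omega>" and dim_ge2: "2 \<le> CARD('n)"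
begin

lemma compact_frontier_dom: "compact (frontier \<Omega>)"
  using bounded_dom by (rule compact_frontier_bounded)

text \<open>The bound by a sum over \<open>UNIV - {k}\<close> encodes Lipschitz continuity and
  independence of coordinate \<open>k\<close> at once. The final graph clause is not part of
  \<open>lipschitz_boundary\<close>; it is derived in \<open>lipschitz_chart\<close>.\<close>

definition boundary_chart ::
  "real^'n \<Rightarrow> real \<Rightarrow> (real^'n \<Rightarrow> real^'n) \<Rightarrow> 'n \<Rightarrow> (real^'n \<Rightarrow> real) \<Rightarrow> real \<Rightarrow> bool" where
  "boundary_chart x0 r R k \<psi> L \<longleftrightarrow> 0 < r \<and> 0 < (L::real) \<and> orthogonal_transformation R \<and>
    (\<forall>y z. \<bar>\<psi> y - \<psi> z\<bar> \<le> L * (\<Sum>i\<in>UNIV - {k}. \<bar>y $ i - z $ i\<bar>)) \<and>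
    (\<forall>y z. \<bar>\<psi> y - \<psi> z\<bar> \<le> L * norm (y - z)) \<and>
    (\<forall>x\<in>ball x0 r. x \<in> \<Omega> \<longleftrightarrow> R (x - x0) $ k < \<psi> (R (x - x0))) \<and>
    (\<forall>x\<in>ball x0 r \<inter> frontier \<Omega>. R (x - x0) $ k = \<psi> (R (x - x0)))"

text \<open>The new content is the graph clause. A frontier point is outside the open set
  \<open>\<Omega>\<close>, hence not below the graph; were it strictly above, a whole neighbourhood
  would miss \<open>\<Omega>\<close>, although the point lies in the closure.\<close>

lemma lipschitz_chart:
  assumes x0: "x0 \<in> frontier \<Omega>"
  shows "\<exists>r R k \<psi> L. boundary_chart x0 r R k \<psi> L"
proof -
  obtain r and R :: "real^'n \<Rightarrow> real^'n" and k \<psi> L0 where r: "0 < r" and chart: "orthogonal_transformation R \<and>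
      (\<forall>y z. (\<forall>i. i \<noteq> k \<longrightarrow> y $ i = z $ i) \<longrightarrow> \<psi> y = \<psi> z) \<and>
      (\<forall>y z. \<bar>\<psi> y - \<psi> z\<bar> \<le> L0 * norm (y - z)) \<and>
      (\<forall>x\<in>ball x0 r. x \<in> \<Omega> \<longleftrightarrow> R (x - x0) $ k < \<psi> (R (x - x0)))"
    using bspec[OF lipschitz_dom[unfolded lipschitz_boundary_def] x0] by (elim exE conjE) (rule that, assumption, intro conjI, assumption+)
  from chart have R: "orthogonal_transformation R"
    and indep: "\<And>y z. (\<forall>i. i \<noteq> k \<longrightarrow> y $ i = z $ i) \<Longrightarrow> \<psi> y = \<psi> z"
    and lip0: "\<And>y z. \<bar>\<psi> y - \<psi> z\<bar> \<le> L0 * norm (y - z)"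
    and dom: "\<And>x. x \<in> ball x0 r \<Longrightarrow> x \<in> \<Omega> \<longleftrightarrow> R (x - x0) $ k < \<psi> (R (x - x0))"
    by simp_all
  define L where "L = \<bar>L0\<bar> + 1"
  have L: "0 < L" by (simp add: L_def)
  have lip: "\<bar>\<psi> y - \<psi> z\<bar> \<le> L * norm (y - z)" for y z
  proof -
    have "L0 * norm (y - z) \<le> L * norm (y - z)" by (rule mult_right_mono) (auto simp: L_def)
    with lip0[of y z] show ?thesis by linarith
  qed
  have lip': "\<bar>\<psi> y - \<psi> z\<bar> \<le> L * (\<Sum>i\<in>UNIV - {k}. \<bar>y $ i - z $ i\<bar>)" for y z
  proof -
    \<comment> \<open>\<open>z'\<close> takes coordinate \<open>k\<close> from \<open>y\<close>:
      \<open>\<psi>\<close> does not notice, and the \<open>k\<close>-term of the norm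
      disappears.\<close>
    define z' where "z' = (\<chi> i. if i = k then y $ k else z $ i)"
    have "\<psi> z = \<psi> z'" by (rule indep) (simp add: z'_def)
    then have "\<bar>\<psi> y - \<psi> z\<bar> \<le> L * norm (y - z')" using lip[of y z'] by simp
    also have "norm (y - z') \<le> (\<Sum>i\<in>UNIV. \<bar>(y - z') $ i\<bar>)" by (rule norm_le_l1_cart)
    also have "\<dots> = (\<Sum>i\<in>UNIV - {k}. \<bar>(y - z') $ i\<bar>)"
      by (rule sum.mono_neutral_right) (auto simp: z'_def)
    also have "\<dots> = (\<Sum>i\<in>UNIV - {k}. \<bar>y $ i - z $ i\<bar>)"
      by (rule sum.cong) (auto simp: z'_def)
    finally show ?thesis using L by simp
  qed
  have norm_R: "norm (R x - R y) = norm (x - y)" for x y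
    using R by (metis orthogonal_transformation_linear linear_diff orthogonal_transformation_norm)
  have graph: "R (x - x0) $ k = \<psi> (R (x - x0))" if x: "x \<in> ball x0 r" "x \<in> frontier \<Omega>" for x
  proof (rule antisym)
    define F where "F y = \<psi> (R (y - x0)) - R (y - x0) $ k" for y
    have F_lip: "\<bar>F y - F x\<bar> \<le> (L + 1) * norm (y - x)" for y
    proof -
      have "\<bar>R (y - x0) $ k - R (x - x0) $ k\<bar> \<le> norm (y - x)"
        using component_le_norm_cart[of "R (y - x0) - R (x - x0)" k] by (simp add: norm_R)
      moreover have "\<bar>\<psi> (R (y - x0)) - \<psi> (R (x - x0))\<bar> \<le> L * norm (y - x)"
        using lip[of "R (y - x0)" "R (x - x0)"] by (simp add: norm_R)
      ultimately show ?thesis by (simp add: F_def algebra_simps)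
    qed
    have "x \<notin> \<Omega>" using x(2) open_dom by (simp add: frontier_def interior_open)
    then show "\<psi> (R (x - x0)) \<le> R (x - x0) $ k" using dom[OF x(1)] by simp
    show "R (x - x0) $ k \<le> \<psi> (R (x - x0))"
    proof (rule ccontr)
      assume "\<not> ?thesis"
      then have neg: "F x < 0" by (simp add: F_def)
      \<comment> \<open>The first bound keeps \<open>F\<close> negative near \<open>x\<close>, the
        second keeps \<open>y\<close> inside the chart.\<close>
      define \<epsilon> where "\<epsilon> = min (- F x / (L + 1)) (r - dist x0 x)"
      have "0 < - F x / (L + 1)" using neg L by (intro divide_pos_pos) auto
      then have "0 < \<epsilon>" using x(1) by (simp add: \<epsilon>_def)
      then obtain y where y: "y \<in> \<Omega>" "dist y x < \<epsilon>"
        using x(2) unfolding frontier_def by (auto simp: closure_approachable)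
      have "dist x0 y \<le> dist x0 x + dist x y" by (rule dist_triangle)
      then have "y \<in> ball x0 r" using y(2) by (simp add: \<epsilon>_def dist_commute)
      then have "0 < F y" using dom y(1) by (simp add: F_def)
      moreover have "(L + 1) * norm (y - x) < - F x"
        using y(2) L by (simp add: \<epsilon>_def dist_norm field_simps)
      ultimately show False using F_lip[of y] by linarith
    qed
  qed
  have "boundary_chart x0 r R k \<psi> L"
    unfolding boundary_chart_def using r L R lip' lip dom graph by blast
  then show ?thesis by blast
qed

text \<open>On the graph, coordinate \<open>k\<close> is controlled by the others, so forgetting it
  has a Lipschitz inverse with constant \<open>1 + L\<close>, and the grid bound applies with the
  remaining \<open>CARD('n) - 1\<close> coordinates.\<close>

lemma frontier_ahlfors_local:
  assumes x0: "x0 \<in> frontier \<Omega>"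
  shows "\<exists>r>0. \<exists>C\<ge>0. \<forall>A D. A \<subseteq> frontier \<Omega> \<inter> ball x0 r \<longrightarrow> 0 < D \<longrightarrow>
    (\<forall>y\<in>A. \<forall>z\<in>A. dist y z \<le> D) \<longrightarrow> hausdorff_outer (real CARD('n) - 1) A \<le> ennreal (C * D ^ (CARD('n) - 1))"
proof -
  obtain r R k \<psi> L where "boundary_chart x0 r R k \<psi> L" using lipschitz_chart[OF x0] by blast
  then have r: "0 < r" and L: "0 < L" and R: "orthogonal_transformation R"
    and lip: "\<And>y z. \<bar>\<psi> y - \<psi> z\<bar> \<le> L * (\<Sum>i\<in>UNIV - {k}. \<bar>y $ i - z $ i\<bar>)"
    and graph: "\<And>x. x \<in> ball x0 r \<Longrightarrow> x \<in> frontier \<Omega> \<Longrightarrow> R (x - x0) $ k = \<psi> (R (x - x0))"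
    unfolding boundary_chart_def by blast+
  define m where "m = CARD('n) - 1"
  have m: "real CARD('n) - 1 = real m" "0 < m" "card (UNIV - {k}) = m" using dim_ge2 by (auto simp: m_def)
  define p where "p i y = R (y - x0) $ i" for i y
  have norm_R: "norm (R x - R y) = norm (x - y)" for x y
    using R by (metis orthogonal_transformation_linear linear_diff orthogonal_transformation_norm)
  define C where "C = (pi powr (m / 2) / Gamma (m / 2 + 1)) * (3 * (1 + L) * m / 2) ^ m"
  have C: "0 \<le> C" unfolding C_def using hausdorff_constant_pos[of m] L by simp
  have "hausdorff_outer m A \<le> ennreal (C * D ^ m)"
    if A: "A \<subseteq> frontier \<Omega> \<inter> ball x0 r" and D: "0 < D" and diam: "\<forall>y\<in>A. \<forall>z\<in>A. dist y z \<le> D" for A D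
    unfolding C_def
  proof (rule hausdorff_outer_bilipschitz_coordinates[where K="UNIV - {k}" and p=p])
    fix i y z assume yz: "y \<in> A" "z \<in> A"
    have "\<bar>p i y - p i z\<bar> \<le> norm (y - z)"
      using component_le_norm_cart[of "R (y - x0) - R (z - x0)" i] by (simp add: p_def norm_R)
    then show "\<bar>p i y - p i z\<bar> \<le> D" using diam yz by (auto simp: dist_norm intro: order_trans)
  next
    fix y z assume yz: "y \<in> A" "z \<in> A"
    have k: "\<bar>p k y - p k z\<bar> \<le> L * (\<Sum>i\<in>UNIV - {k}. \<bar>p i y - p i z\<bar>)"
    proof -
      have "y \<in> ball x0 r" "z \<in> ball x0 r" "y \<in> frontier \<Omega>" "z \<in> frontier \<Omega>" using yz A by blast+
      then show ?thesis
        using lip[of "R (y - x0)" "R (z - x0)"] graph[of y] graph[of z] by (simp add: p_def)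
    qed
    have "dist y z = norm (R (y - x0) - R (z - x0))" by (simp add: norm_R dist_norm)
    also have "\<dots> \<le> (\<Sum>i\<in>UNIV. \<bar>(R (y - x0) - R (z - x0)) $ i\<bar>)" by (rule norm_le_l1_cart)
    also have "\<dots> = (\<Sum>i\<in>UNIV. \<bar>p i y - p i z\<bar>)" by (simp add: p_def)
    also have "\<dots> = \<bar>p k y - p k z\<bar> + (\<Sum>i\<in>UNIV - {k}. \<bar>p i y - p i z\<bar>)"
      by (rule sum.remove) auto
    finally show "dist y z \<le> (1 + L) * (\<Sum>i\<in>UNIV - {k}. \<bar>p i y - p i z\<bar>)"
      using k by (simp add: algebra_simps)
  qed (use m L D in auto)
  then show ?thesis unfolding m(1) m_def[symmetric] using r C by blast
qed

text \<open>Upper Ahlfors regularity of codimension one. Arbitrary sets with bounded pairwise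
  distances take the place of balls, so the bound covers the whole frontier as well as balls around
  points.\<close>

definition frontier_regular :: "real \<Rightarrow> bool" where
  "frontier_regular C \<longleftrightarrow> 0 \<le> C \<and> (\<forall>A D. A \<subseteq> frontier \<Omega> \<longrightarrow> 0 < D \<longrightarrow> (\<forall>y\<in>A. \<forall>z\<in>A. dist y z \<le> D)
    \<longrightarrow> hausdorff_outer (real CARD('n) - 1) A \<le> ennreal (C * D ^ (CARD('n) - 1)))"

lemma frontier_regularD:
  assumes "frontier_regular C"
  shows "0 \<le> C"
    and "A \<subseteq> frontier \<Omega> \<Longrightarrow> 0 < D \<Longrightarrow> (\<And>y z. y \<in> A \<Longrightarrow> z \<in> A \<Longrightarrow> dist y z \<le> D)
      \<Longrightarrow> hausdorff_outer (real CARD('n) - 1) A \<le> ennreal (C * D ^ (CARD('n) - 1))"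
  using assms by (simp_all add: frontier_regular_def)

text \<open>Finitely many chart balls cover the compact frontier. The pieces of a set in these balls
  are measured separately, so the local constants add up.\<close>

lemma frontier_ahlfors: "\<exists>C. frontier_regular C"
proof -
  let ?H = "hausdorff_outer (real CARD('n) - 1) :: (real^'n) set \<Rightarrow> ennreal"
  define Good where "Good x r C \<longleftrightarrow> 0 < r \<and> 0 \<le> C \<and> (\<forall>A D. A \<subseteq> frontier \<Omega> \<inter> ball x r \<longrightarrow> 0 < D \<longrightarrow>
    (\<forall>y\<in>A. \<forall>z\<in>A. dist y z \<le> D) \<longrightarrow> ?H A \<le> ennreal (C * D ^ (CARD('n) - 1)))" for x r C
  have "\<forall>x\<in>frontier \<Omega>. \<exists>r C. Good x r C"
  proof
    fix x assume "x \<in> frontier \<Omega>"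
    from frontier_ahlfors_local[OF this] show "\<exists>r C. Good x r C"
      unfolding Good_def by (elim exE conjE) (rule exI, rule exI, intro conjI, assumption+)
  qed
  then obtain r C where Good: "\<And>x. x \<in> frontier \<Omega> \<Longrightarrow> Good x (r x) (C x)" by metis
  have rC1: "0 < r x" if "x \<in> frontier \<Omega>" for x
    using Good[OF that] unfolding Good_def by (rule conjunct1)
  have rC2: "0 \<le> C x" if "x \<in> frontier \<Omega>" for x
    using Good[OF that] unfolding Good_def by (rule conjunct1[OF conjunct2])
  have rC3: "?H A \<le> ennreal (C x * D ^ (CARD('n) - 1))"
    if "x \<in> frontier \<Omega>" "A \<subseteq> frontier \<Omega> \<inter> ball x (r x)" "0 < D" "\<forall>y\<in>A. \<forall>z\<in>A. dist y z \<le> D" for x A D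
  proof -
    have "\<forall>A D. A \<subseteq> frontier \<Omega> \<inter> ball x (r x) \<longrightarrow> 0 < D \<longrightarrow>
      (\<forall>y\<in>A. \<forall>z\<in>A. dist y z \<le> D) \<longrightarrow> ?H A \<le> ennreal (C x * D ^ (CARD('n) - 1))"
      using Good[OF that(1)] unfolding Good_def by (rule conjunct2[OF conjunct2])
    from this[THEN spec, THEN spec, THEN mp, THEN mp, THEN mp, OF that(2-4)] show ?thesis .
  qed
  obtain X where X: "X \<subseteq> frontier \<Omega>" "finite X" "frontier \<Omega> \<subseteq> (\<Union>x\<in>X. ball x (r x))"
    using compactE_image[OF compact_frontier_dom, of "frontier \<Omega>" "\<lambda>x. ball x (r x)"] rC1 by force
  have "frontier_regular (\<Sum>x\<in>X. C x)"
    unfolding frontier_regular_def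
  proof (intro conjI allI impI)
    show "0 \<le> (\<Sum>x\<in>X. C x)" using X rC2 by (intro sum_nonneg) auto
    fix A D assume A: "A \<subseteq> frontier \<Omega>" and D: "0 < (D::real)"
      and diam: "\<forall>y\<in>A. \<forall>z\<in>A. dist y z \<le> D"
    have sub: "?H (A \<inter> (\<Union>x\<in>Y. ball x (r x))) \<le> (\<Sum>x\<in>Y. ?H (A \<inter> ball x (r x)))" if "finite Y" for Y
      using that
    proof (induction Y rule: finite_induct)
      case (insert x Y)
      have "?H (A \<inter> (\<Union>x\<in>insert x Y. ball x (r x))) \<le> ?H (A \<inter> ball x (r x)) + ?H (A \<inter> (\<Union>x\<in>Y. ball x (r x)))"
        using hausdorff_outer_Un[of _ "A \<inter> ball x (r x)" "A \<inter> (\<Union>x\<in>Y. ball x (r x))"] by (simp add: Int_Un_distrib)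
      then show ?case using insert by (auto intro: order_trans add_left_mono)
    qed simp
    have "A \<inter> (\<Union>x\<in>X. ball x (r x)) = A" using A X(3) by blast
    then have "?H A \<le> (\<Sum>x\<in>X. ?H (A \<inter> ball x (r x)))"
      using sub[OF X(2)] by simp
    also have "\<dots> \<le> (\<Sum>x\<in>X. ennreal (C x * D ^ (CARD('n) - 1)))"
      using X A D diam by (intro sum_mono rC3) auto
    also have "\<dots> = ennreal ((\<Sum>x\<in>X. C x) * D ^ (CARD('n) - 1))"
      using X rC2 D by (subst sum_ennreal) (auto simp: sum_distrib_right)
    finally show "?H A \<le> ennreal ((\<Sum>x\<in>X. C x) * D ^ (CARD('n) - 1))" .
  qed
  then show ?thesis by blast
qed

lemma finite_measure_surface: "finite_measure (surface_measure \<Omega>)"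
proof
  obtain C where "frontier_regular C" using frontier_ahlfors by blast
  note C = frontier_regularD[OF this]
  have bd: "bounded (frontier \<Omega>)" using compact_frontier_dom by (rule compact_imp_bounded)
  have "emeasure (surface_measure \<Omega>) (space (surface_measure \<Omega>)) = hausdorff_outer (real CARD('n) - 1) (frontier \<Omega>)"
    using emeasure_surface_measure[OF sets.top, of \<Omega>] by simp
  \<comment> \<open>Adding 1 supplies the strictly positive bound that
    \<open>frontier_regular\<close> asks for.\<close>
  also have "\<dots> \<le> ennreal (C * (diameter (frontier \<Omega>) + 1) ^ (CARD('n) - 1))"
    using diameter_bounded_bound[OF bd] diameter_ge_0[OF bd] by (intro C(2)) (force intro: add_increasing2)+
  finally show "emeasure (surface_measure \<Omega>) (space (surface_measure \<Omega>)) \<noteq> \<infinity>"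
    by (auto simp: top_unique)
qed

lemma surface_measure_pos: "0 < measure (surface_measure \<Omega>) (frontier \<Omega>)"
proof -
  interpret finite_measure "surface_measure \<Omega>" by (rule finite_measure_surface)
  have "0 < emeasure (surface_measure \<Omega>) (frontier \<Omega>)"
    using emeasure_surface_measure[OF sets.top, of \<Omega>] hausdorff_outer_frontier_pos[OF open_dom bounded_dom nonempty_dom dim_ge2]
    by simp
  then show ?thesis by (simp add: emeasure_eq_measure)
qed

section \<open>Integration on the frontier and the Gagliardo seminorm\<close>

lemma measurable_surface_id [measurable]: "(\<lambda>x. x) \<in> measurable (surface_measure \<Omega>) borel"
  by (subst measurable_cong_sets[OF sets_surface_measure refl]) (simp add: measurable_restrict_space1)

lemma borel_measurable_surface_continuous:
  "continuous_on (frontier \<Omega>) g \<Longrightarrow> g \<in> borel_measurable (surface_measure \<Omega>)"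
  by (subst measurable_cong_sets[OF sets_surface_measure refl]) (rule borel_measurable_continuous_on_restrict)

lemma integrable_surface_continuous:
  fixes g :: "real^'n \<Rightarrow> real"
  assumes "continuous_on (frontier \<Omega>) g"
  shows "integrable (surface_measure \<Omega>) g"
proof -
  interpret finite_measure "surface_measure \<Omega>" by (rule finite_measure_surface)
  obtain B where "\<And>x. x \<in> frontier \<Omega> \<Longrightarrow> norm (g x) \<le> B"
    using compact_imp_bounded[OF compact_continuous_image[OF assms compact_frontier_dom]]
    by (auto simp: bounded_iff)
  then show ?thesis
    by (intro integrable_const_bound[where B=B] borel_measurable_surface_continuous assms) auto
qed

lemma closed_in_sets_surface: "closed S \<Longrightarrow> S \<inter> frontier \<Omega> \<in> sets (surface_measure \<Omega>)"
  unfolding sets_surface_measure sets_restrict_space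
  by (rule image_eqI[of _ _ S]) (simp_all add: Int_commute)

text \<open>At distance about \<open>t\<close> from \<open>x\<close> the Lipschitz bound contributes
  \<open>t^2\<close>, the kernel \<open>t^(-d)\<close> and the measure \<open>t^(d - 1)\<close>, so
  an annulus costs a multiple of \<open>t\<close>. \<open>B\<close> is chosen before
  \<open>g\<close>, \<open>L\<close> and \<open>x\<close>; uniformity in \<open>x\<close> is what
  the outer integral needs.\<close>

lemma gagliardo_inner_bound:
  "\<exists>B\<ge>0. \<forall>g L. \<forall>x\<in>frontier \<Omega>. 0 \<le> L \<longrightarrow> L-lipschitz_on (frontier \<Omega>) g \<longrightarrow>
    (\<integral>\<^sup>+ y. ennreal (gagliardo_integrand g (x, y)) \<partial>surface_measure \<Omega>) \<le> ennreal (L\<^sup>2 * B)"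
proof -
  let ?\<mu> = "surface_measure \<Omega>"
  obtain C where "frontier_regular C" using frontier_ahlfors by blast
  note C = frontier_regularD[OF this]
  define m where "m = CARD('n) - 1"
  have m: "CARD('n) = Suc m" using dim_ge2 by (simp add: m_def)
  have bd: "bounded (frontier \<Omega>)" using compact_frontier_dom by (rule compact_imp_bounded)
  define D where "D = diameter (frontier \<Omega>) + 1"
  have D: "0 < D" using diameter_ge_0[OF bd] by (simp add: D_def)
  have D_bd: "dist x y \<le> D" if "x \<in> frontier \<Omega>" "y \<in> frontier \<Omega>" for x y
    using diameter_bounded_bound[OF bd that] by (simp add: D_def)
  define t where "t k = D / 2 ^ k" for k :: nat
  have t: "0 < t k" for k using D by (simp add: t_def)
  have tS: "t (Suc k) = t k / 2" for k by (simp add: t_def)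
  \<comment> \<open>\<open>2 ^ (2 * m + 1)\<close> collects \<open>2 ^ (m + 1)\<close> from the
    inner radius \<open>t (Suc k) = t k / 2\<close> and \<open>2 ^ m\<close> from the diameter of
    the ball; \<open>2 * D\<close> is the sum of all \<open>t k\<close>.\<close>
  define B where "B = C * 2 ^ (2 * m + 1) * (2 * D)"
  have B: "0 \<le> B" using C D by (simp add: B_def)
  have meas: "emeasure ?\<mu> (cball x r \<inter> frontier \<Omega>) \<le> ennreal (C * (2 * r) ^ m)" if "0 < r" for x r
  proof -
    have "cball x r \<inter> frontier \<Omega> \<in> sets ?\<mu>"
      by (rule closed_in_sets_surface) simp
    then have "emeasure ?\<mu> (cball x r \<inter> frontier \<Omega>) = hausdorff_outer (real CARD('n) - 1) (cball x r \<inter> frontier \<Omega>)"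
      by (rule emeasure_surface_measure)
    also have "\<dots> \<le> ennreal (C * (2 * r) ^ m)"
      unfolding m_def
    proof (rule C(2))
      fix y z assume "y \<in> cball x r \<inter> frontier \<Omega>" "z \<in> cball x r \<inter> frontier \<Omega>"
      then show "dist y z \<le> 2 * r" using dist_triangle3[of y z x] by auto
    qed (use that in auto)
    finally show ?thesis .
  qed
  have "(\<integral>\<^sup>+ y. ennreal (gagliardo_integrand g (x, y)) \<partial>?\<mu>) \<le> ennreal (L\<^sup>2 * B)"
    if L: "0 \<le> L" and lip: "L-lipschitz_on (frontier \<Omega>) g" and x: "x \<in> frontier \<Omega>" for g L x
  proof -
    define b where "b k = L\<^sup>2 * (t k)\<^sup>2 / (t (Suc k)) ^ Suc m" for k
    have b: "0 \<le> b k" for k using t by (simp add: b_def less_imp_le)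
    have ptwise: "ennreal (gagliardo_integrand g (x, y)) \<le> (\<Sum>k. ennreal (b k) * indicator (cball x (t k) \<inter> frontier \<Omega>) y)"
      if y: "y \<in> frontier \<Omega>" for y
    proof (cases "x = y")
      case True
      then show ?thesis by (simp add: gagliardo_integrand_def)
    next
      case False
      then have dpos: "0 < dist x y" by simp
      \<comment> \<open>The index of the annulus containing \<open>y\<close>. The series runs over
        full balls, so this single term already bounds the integrand.\<close>
      define k where "k = (LEAST k. t (Suc k) < dist x y)"
      have "(\<lambda>k. D * (1 / 2) ^ Suc k) \<longlonglongrightarrow> D * 0"
        by (intro tendsto_mult tendsto_const LIMSEQ_Suc LIMSEQ_power_zero) auto
      then have "\<forall>\<^sub>F k in sequentially. D * (1 / 2) ^ Suc k < dist x y"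
        by (rule order_tendstoD(2)) (use dpos in simp)
      then obtain k0 where "D * (1 / 2) ^ Suc k0 < dist x y"
        using eventually_happens'[OF sequentially_bot] by blast
      then have "t (Suc k0) < dist x y"
        by (simp only: t_def power_one_over times_divide_eq_right mult_1_right)
      then have k1: "t (Suc k) < dist x y" unfolding k_def by (rule LeastI)
      have k2: "dist x y \<le> t k"
      proof (cases k)
        case 0
        then show ?thesis using D_bd[OF x y] by (simp add: t_def)
      next
        case (Suc i)
        then show ?thesis using not_less_Least[of i "\<lambda>k. t (Suc k) < dist x y"] k_def by simp
      qed
      have gl: "\<bar>g x - g y\<bar> \<le> L * dist x y"
        using lipschitz_onD[OF lip x y] by (simp add: dist_real_def)
      have "(g x - g y)\<^sup>2 \<le> L\<^sup>2 * (t k)\<^sup>2"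
      proof -
        have "\<bar>g x - g y\<bar> \<le> L * t k" using gl mult_left_mono[OF k2 L] by linarith
        then show ?thesis by (metis abs_ge_zero power2_abs power_mono power_mult_distrib)
      qed
      moreover have "t (Suc k) ^ Suc m \<le> norm (x - y) powr real CARD('n)"
      proof -
        have "t (Suc k) ^ Suc m \<le> norm (x - y) ^ Suc m"
          using k1 less_imp_le[OF t] by (intro power_mono) (simp_all add: dist_norm less_imp_le)
        also have "\<dots> = norm (x - y) powr real CARD('n)"
          using dpos unfolding m by (subst powr_realpow) (simp_all add: dist_norm)
        finally show ?thesis .
      qed
      ultimately have "gagliardo_integrand g (x, y) \<le> b k"
        unfolding gagliardo_integrand_def b_def using t[of "Suc k"] by (auto intro!: frac_le)
      then have "ennreal (gagliardo_integrand g (x, y)) \<le> ennreal (b k) * indicator (cball x (t k) \<inter> frontier \<Omega>) y"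
        using k2 y by (simp add: ennreal_leI)
      also have "\<dots> \<le> (\<Sum>k. ennreal (b k) * indicator (cball x (t k) \<inter> frontier \<Omega>) y)"
        by (rule ennreal_le_suminf)
      finally show ?thesis .
    qed
    have sets: "cball x r \<inter> frontier \<Omega> \<in> sets ?\<mu>" for r
      by (rule closed_in_sets_surface) simp
    have "(\<integral>\<^sup>+ y. ennreal (gagliardo_integrand g (x, y)) \<partial>?\<mu>)
        \<le> (\<integral>\<^sup>+ y. (\<Sum>k. ennreal (b k) * indicator (cball x (t k) \<inter> frontier \<Omega>) y) \<partial>?\<mu>)"
      by (intro nn_integral_mono) (simp add: ptwise)
    also have "\<dots> = (\<Sum>k. ennreal (b k) * emeasure ?\<mu> (cball x (t k) \<inter> frontier \<Omega>))"
      using sets by (subst nn_integral_suminf) (auto simp: nn_integral_cmult_indicator)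
    also have "\<dots> \<le> (\<Sum>k. ennreal (b k) * ennreal (C * (2 * t k) ^ m))"
      using meas t by (intro suminf_le mult_left_mono) auto
    also have "\<dots> = (\<Sum>k. ennreal (L\<^sup>2 * C * 2 ^ (2 * m + 1) * D * (1 / 2) ^ k))"
    proof (rule suminf_cong)
      fix k
      have eq: "b k * (C * (2 * t k) ^ m) = L\<^sup>2 * C * 2 ^ (2 * m + 1) * t k"
      proof -
        \<comment> \<open>Applied with \<open>s = t k\<close>, \<open>P = t k ^ m\<close> and
          \<open>A = 2 ^ m\<close>.\<close>
        have cancel: "s\<^sup>2 / ((s * P) / (2 * A)) * (A * P) = 2 * A * A * s" if "s \<noteq> 0" "P \<noteq> 0" "A \<noteq> 0" for s P A :: real
          using that by (simp add: power2_eq_square)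
        have "b k * (C * (2 * t k) ^ m) = L\<^sup>2 * C * ((t k)\<^sup>2 / ((t k * t k ^ m) / (2 * 2 ^ m)) * (2 ^ m * t k ^ m))"
          by (simp add: b_def tS power_mult_distrib power_divide)
        also have "\<dots> = L\<^sup>2 * C * (2 * 2 ^ m * 2 ^ m * t k)"
          using t[of k] by (subst cancel) auto
        also have "2 * 2 ^ m * 2 ^ m = (2::real) ^ (2 * m + 1)" 
          by (simp add: power_even_eq power2_eq_square)
        finally show ?thesis by (simp only: mult.assoc)
      qed
      show "ennreal (b k) * ennreal (C * (2 * t k) ^ m) = ennreal (L\<^sup>2 * C * 2 ^ (2 * m + 1) * D * (1 / 2) ^ k)"
      proof -
        have "t k = D * (1 / 2) ^ k" by (simp add: t_def power_one_over)
        with eq have "b k * (C * (2 * t k) ^ m) = L\<^sup>2 * C * 2 ^ (2 * m + 1) * D * (1 / 2) ^ k"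
          by (simp only: mult.assoc)
        then show ?thesis by (simp only: ennreal_mult'[OF b, symmetric])
      qed
    qed
    also have "\<dots> = ennreal (L\<^sup>2 * B)"
    proof -
      have "(\<lambda>k. (L\<^sup>2 * C * 2 ^ (2 * m + 1) * D) * (1 / 2) ^ k) sums ((L\<^sup>2 * C * 2 ^ (2 * m + 1) * D) * (1 / (1 - 1 / 2)))"
        by (intro sums_mult geometric_sums) simp
      then show ?thesis using C D L
        by (intro suminf_ennreal_eq) (auto simp: B_def mult_ac)
    qed
    finally show ?thesis .
  qed
  with B show ?thesis by blast
qed

text \<open>Tonelli: the inner integrals are bounded uniformly and the outer measure is
  finite.\<close>

lemma lipschitz_in_H_half:
  assumes lip: "L-lipschitz_on (frontier \<Omega>) g"
  shows "g \<in> H_half \<Omega>"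
proof -
  let ?\<mu> = "surface_measure \<Omega>"
  interpret finite_measure ?\<mu> by (rule finite_measure_surface)
  interpret P: pair_sigma_finite ?\<mu> ?\<mu> ..
  have cont: "continuous_on (frontier \<Omega>) g" using lip by (rule lipschitz_on_continuous_on)
  have g [measurable]: "g \<in> borel_measurable ?\<mu>" by (rule borel_measurable_surface_continuous[OF cont])
  have sq: "integrable ?\<mu> (\<lambda>x. (g x)\<^sup>2)" by (intro integrable_surface_continuous continuous_intros cont)
  have fstm [measurable]: "fst \<in> measurable (?\<mu> \<Otimes>\<^sub>M ?\<mu>) borel"
    using measurable_compose[OF measurable_fst measurable_surface_id] by simp
  have sndm [measurable]: "snd \<in> measurable (?\<mu> \<Otimes>\<^sub>M ?\<mu>) borel"
    using measurable_compose[OF measurable_snd measurable_surface_id] by simp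
  have gag [measurable]: "gagliardo_integrand g \<in> borel_measurable (?\<mu> \<Otimes>\<^sub>M ?\<mu>)"
    unfolding gagliardo_integrand_def case_prod_beta by measurable
  obtain B where B: "0 \<le> B" "\<And>g L x. \<lbrakk>0 \<le> L; L-lipschitz_on (frontier \<Omega>) g; x \<in> frontier \<Omega>\<rbrakk> \<Longrightarrow>
    (\<integral>\<^sup>+ y. ennreal (gagliardo_integrand g (x, y)) \<partial>?\<mu>) \<le> ennreal (L\<^sup>2 * B)"
    using gagliardo_inner_bound by meson
  have nonneg: "0 \<le> gagliardo_integrand g z" for z
    by (simp add: gagliardo_integrand_def case_prod_beta)
  have "(\<integral>\<^sup>+ z. ennreal (norm (gagliardo_integrand g z)) \<partial>(?\<mu> \<Otimes>\<^sub>M ?\<mu>))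
      = (\<integral>\<^sup>+ x. \<integral>\<^sup>+ y. ennreal (gagliardo_integrand g (x, y)) \<partial>?\<mu> \<partial>?\<mu>)"
    using nonneg nn_integral_fst[of "\<lambda>z. ennreal (gagliardo_integrand g z)" ?\<mu>] by simp
  also have "\<dots> \<le> (\<integral>\<^sup>+ x. ennreal (L\<^sup>2 * B) \<partial>?\<mu>)"
    using lipschitz_on_nonneg[OF lip] by (intro nn_integral_mono B(2) lip) auto
  also have "\<dots> < \<infinity>" by (simp add: emeasure_eq_measure ennreal_mult_less_top)
  finally have "integrable (?\<mu> \<Otimes>\<^sub>M ?\<mu>) (gagliardo_integrand g)"
    by (intro integrableI_bounded) auto
  with g sq show ?thesis by (simp add: H_half_def)
qed

end

section \<open>Forms on spaces of functions\<close>

text \<open>Subspaces are sets of plain functions. The two-scalar combination covers sums,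
  differences and multiples in one operation; the explicit factors \<open>1\<close> and
  \<open>-1\<close> in later proofs are instances of it.\<close>

definition function_space :: "('a \<Rightarrow> real) set \<Rightarrow> bool" where
  "function_space V \<longleftrightarrow> (\<lambda>x. 0) \<in> V \<and> (\<forall>u\<in>V. \<forall>v\<in>V. \<forall>a b. (\<lambda>x. a * u x + b * v x) \<in> V)"

definition linear_form :: "('a \<Rightarrow> real) set \<Rightarrow> (('a \<Rightarrow> real) \<Rightarrow> real) \<Rightarrow> bool" where
  "linear_form V l \<longleftrightarrow> (\<forall>u\<in>V. \<forall>v\<in>V. \<forall>a b. l (\<lambda>x. a * u x + b * v x) = a * l u + b * l v)"

definition symmetric_form :: "('a \<Rightarrow> real) set \<Rightarrow> (('a \<Rightarrow> real) \<Rightarrow> ('a \<Rightarrow> real) \<Rightarrow> real) \<Rightarrow> bool" where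
  "symmetric_form V e \<longleftrightarrow> (\<forall>u\<in>V. linear_form V (e u)) \<and> (\<forall>u\<in>V. \<forall>v\<in>V. e u v = e v u)"

definition definite_form :: "('a \<Rightarrow> real) set \<Rightarrow> (('a \<Rightarrow> real) \<Rightarrow> ('a \<Rightarrow> real) \<Rightarrow> real) \<Rightarrow> bool" where
  "definite_form V e \<longleftrightarrow> symmetric_form V e \<and> (\<forall>u\<in>V. 0 \<le> e u u) \<and> (\<forall>u\<in>V. e u u = 0 \<longrightarrow> u = (\<lambda>x. 0))"

lemma function_spaceD:
  assumes "function_space V"
  shows "(\<lambda>x. 0) \<in> V" "u \<in> V \<Longrightarrow> v \<in> V \<Longrightarrow> (\<lambda>x. a * u x + b * v x) \<in> V"
  using assms unfolding function_space_def by blast+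

lemma linear_formD: "linear_form V l \<Longrightarrow> u \<in> V \<Longrightarrow> v \<in> V \<Longrightarrow> l (\<lambda>x. a * u x + b * v x) = a * l u + b * l v"
  unfolding linear_form_def by blast

lemma linear_form_zero: "linear_form V l \<Longrightarrow> function_space V \<Longrightarrow> l (\<lambda>x. 0) = 0"
  using linear_formD[of V l "\<lambda>x. 0" "\<lambda>x. 0" 0 0] function_spaceD(1)[of V] by simp

lemma symmetric_formD:
  assumes "symmetric_form V e" "u \<in> V" "v \<in> V"
  shows "e u v = e v u" "w \<in> V \<Longrightarrow> e w (\<lambda>x. a * u x + b * v x) = a * e w u + b * e w v"
  using assms by (auto simp: symmetric_form_def linear_form_def)

lemma symmetric_formD_left:
  assumes "function_space V" "symmetric_form V e" "u \<in> V" "v \<in> V" "w \<in> V"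
  shows "e (\<lambda>x. a * u x + b * v x) w = a * e u w + b * e v w"
proof -
  have "e (\<lambda>x. a * u x + b * v x) w = e w (\<lambda>x. a * u x + b * v x)"
    by (intro symmetric_formD(1)[OF assms(2)] function_spaceD(2)[OF assms(1)] assms)
  also have "\<dots> = a * e w u + b * e w v"
    by (rule symmetric_formD(2)[OF assms(2-5)])
  finally show ?thesis
    using symmetric_formD(1)[OF assms(2), of w] assms by simp
qed

lemma linear_form_subset: "linear_form V l \<Longrightarrow> W \<subseteq> V \<Longrightarrow> linear_form W l"
  unfolding linear_form_def by blast

lemma symmetric_form_subset: "symmetric_form V e \<Longrightarrow> W \<subseteq> V \<Longrightarrow> symmetric_form W e"
  by (auto simp: symmetric_form_def linear_form_def subset_iff)

lemma definite_form_subset: "definite_form V e \<Longrightarrow> W \<subseteq> V \<Longrightarrow> definite_form W e"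
  by (auto simp: definite_form_def symmetric_form_subset)

text \<open>Finite dimension is expressed by a finite set \<open>P\<close> of points at which a function of \<open>V\<close> is determined;
  each point removed from \<open>P\<close> costs one orthogonalisation step.\<close>

lemma riesz_finite:
  assumes "finite P" "function_space V" "definite_form V e" "linear_form V l"
    and "\<And>u. u \<in> V \<Longrightarrow> (\<And>p. p \<in> P \<Longrightarrow> u p = 0) \<Longrightarrow> u = (\<lambda>x. 0)"
  shows "\<exists>u\<in>V. \<forall>v\<in>V. e u v = l v"
  using assms
proof (induction P arbitrary: V l rule: finite_induct)
  case empty
  note fs = empty.prems(1) and lin = empty.prems(3)
  have zero: "(\<lambda>x. 0) \<in> V" by (rule function_spaceD(1)[OF fs])
  have V: "v = (\<lambda>x. 0)" if "v \<in> V" for v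
    by (rule empty.prems(4)[OF that]) simp
  have "linear_form V (e (\<lambda>x. 0))"
    using empty.prems(2) zero unfolding definite_form_def symmetric_form_def by blast
  then have "e (\<lambda>x. 0) (\<lambda>x. 0) = l (\<lambda>x. 0)"
    using linear_form_zero[OF _ fs] lin by metis
  then show ?case using zero V by metis
next
  case (insert p P)
  note fs = insert.prems(1) and def = insert.prems(2) and lin = insert.prems(3)
  have sym: "symmetric_form V e" using def by (simp add: definite_form_def)
  note eR = symmetric_formD[OF sym] and eL = symmetric_formD_left[OF fs sym] and lD = linear_formD[OF lin]
  \<comment> \<open>Functions of \<open>W\<close> are determined by their values on \<open>P\<close>
    alone, so the induction hypothesis applies to \<open>W\<close>. It is used for two functionals,
    \<open>e u0\<close> and \<open>l\<close>.\<close>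
  define W where "W = {u \<in> V. u p = 0}"
  have W: "W \<subseteq> V" by (auto simp: W_def)
  have fsW: "function_space W" using fs by (auto simp: function_space_def W_def)
  have IH: "\<exists>u\<in>W. \<forall>v\<in>W. e u v = k v" if "linear_form W k" for k
  proof (rule insert.IH[OF fsW definite_form_subset[OF def W] that])
    fix u assume "u \<in> W" "\<And>q. q \<in> P \<Longrightarrow> u q = 0"
    then show "u = (\<lambda>x. 0)" using insert.prems(4)[of u] by (auto simp: W_def)
  qed
  show ?case
  proof (cases "W = V")
    case True
    then show ?thesis using IH lin by blast
  next
    case False
    then obtain u0 where u0: "u0 \<in> V" "u0 p \<noteq> 0" by (auto simp: W_def)
    have "linear_form V (e u0)" using sym u0 unfolding symmetric_form_def by blast
    then have "linear_form W (e u0)" using W by (rule linear_form_subset)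
    then obtain z where z: "z \<in> W" "\<And>v. v \<in> W \<Longrightarrow> e z v = e u0 v" using IH by blast
    \<comment> \<open>\<open>z\<close> is the \<open>e\<close>-orthogonal projection of
      \<open>u0\<close> to \<open>W\<close>, so \<open>w\<close> is orthogonal to \<open>W\<close>.
      As \<open>w p\<close> is nonzero, every function of \<open>V\<close> is an element of
      \<open>W\<close> plus a multiple of \<open>w\<close>.\<close>
    define w where "w = (\<lambda>x. 1 * u0 x + (-1) * z x)"
    have wV: "w \<in> V" unfolding w_def using u0 z W by (intro function_spaceD(2)[OF fs]) auto
    have wp: "w p \<noteq> 0" using u0 z by (simp add: w_def W_def)
    have w_orth: "e w v = 0" if "v \<in> W" for v
    proof -
      have "z \<in> V" "v \<in> V" using z(1) that W by auto
      then have "e w v = 1 * e u0 v + (-1) * e z v" unfolding w_def by (intro eL u0)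
      then show ?thesis using z(2)[OF that] by simp
    qed
    have ww: "e w w \<noteq> 0"
    proof
      assume "e w w = 0"
      then have "w = (\<lambda>x. 0)" using def wV unfolding definite_form_def by blast
      then show False using wp by simp
    qed
    obtain u1 where u1: "u1 \<in> W" "\<And>v. v \<in> W \<Longrightarrow> e u1 v = l v"
      using IH linear_form_subset[OF lin W] by blast
    \<comment> \<open>The coefficient of \<open>w\<close> is forced by testing with
      \<open>w\<close>; orthogonality keeps this from disturbing the equation on
      \<open>W\<close>.\<close>
    define u where "u = (\<lambda>x. 1 * u1 x + (l w / e w w) * w x)"
    have u1V: "u1 \<in> V" using u1 W by blast
    have uV: "u \<in> V" unfolding u_def by (intro function_spaceD(2)[OF fs] u1V wV)
    have "e u v = l v" if v: "v \<in> V" for v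
    proof -
      define v' where "v' = (\<lambda>x. 1 * v x + (- (v p / w p)) * w x)"
      have v': "v' \<in> W"
        using wp function_spaceD(2)[OF fs v wV, of 1 "- (v p / w p)"] by (simp add: W_def v'_def)
      then have v'V: "v' \<in> V" using W by blast
      have veq: "v = (\<lambda>x. 1 * v' x + (v p / w p) * w x)" by (simp add: v'_def fun_eq_iff)
      have "e u v' = l v'"
        using eL[OF u1V wV v'V, of 1 "l w / e w w"] u1(2)[OF v'] w_orth[OF v'] by (simp add: u_def)
      moreover have "e u w = l w"
        using eL[OF u1V wV wV, of 1 "l w / e w w"] eR(1)[OF u1V wV] w_orth[OF u1(1)] ww by (simp add: u_def)
      moreover have "e u v = 1 * e u v' + (v p / w p) * e u w"
        using eR(2)[OF v'V wV uV, of 1 "v p / w p", folded veq] .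
      moreover have "l v = 1 * l v' + (v p / w p) * l w"
        using lD[OF v'V wV, of 1 "v p / w p", folded veq] .
      ultimately show ?thesis by simp
    qed
    then show ?thesis using uV by blast
  qed
qed

lemma definite_form_unique:
  assumes fs: "function_space V" and def: "definite_form V e" and u: "u \<in> V" "u' \<in> V"
    and eq: "\<And>v. v \<in> V \<Longrightarrow> e u v = e u' v"
  shows "u = u'"
proof -
  have sym: "symmetric_form V e" using def by (simp add: definite_form_def)
  define d where "d = (\<lambda>x. 1 * u x + (-1) * u' x)"
  have d: "d \<in> V" unfolding d_def by (intro function_spaceD(2)[OF fs] u)
  have "e d d = 1 * e u d + (-1) * e u' d"
    by (subst (1) d_def) (rule symmetric_formD_left[OF fs sym u d])
  then have "e d d = 0" using eq[OF d] by simp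
  then have "d = (\<lambda>x. 0)" using def d by (simp add: definite_form_def)
  then show ?thesis by (simp add: d_def fun_eq_iff)
qed

lemma linear_form_add:
  "linear_form W k \<Longrightarrow> linear_form W l \<Longrightarrow> linear_form W (\<lambda>v. c * k v + d * l v)"
  by (simp add: linear_form_def algebra_simps)

lemma form_square_add:
  assumes "function_space W" "symmetric_form W B" "u \<in> W" "v \<in> W"
  shows "B (\<lambda>x. a * u x + b * v x) (\<lambda>x. a * u x + b * v x) = a\<^sup>2 * B u u + 2 * a * b * B u v + b\<^sup>2 * B v v"
proof -
  let ?s = "\<lambda>x. a * u x + b * v x"
  have s: "?s \<in> W" by (rule function_spaceD(2)[OF assms(1,3,4)])
  have "B ?s ?s = a * B u ?s + b * B v ?s"
    by (rule symmetric_formD_left[OF assms(1-4) s])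
  also have "B u ?s = a * B u u + b * B u v" by (rule symmetric_formD(2)[OF assms(2-4,3)])
  also have "B v ?s = a * B v u + b * B v v" by (rule symmetric_formD(2)[OF assms(2-4,4)])
  also have "B v u = B u v" by (rule symmetric_formD(1)[OF assms(2,4,3)])
  finally show ?thesis by (simp add: power2_eq_square algebra_simps)
qed

section \<open>Piecewise affine functions\<close>

locale fem_setting = lipschitz_domain \<Omega> for \<Omega> :: "(real^'n) set" +
  fixes Q :: "real^'n \<Rightarrow> real^'n^'n" and qlow :: real and Th :: "(real^'n) set set"
  assumes connected_dom: "connected \<Omega>" and coeff: "admissible_coefficient \<Omega> Q qlow"
    and finite_Th: "finite Th" and Union_Th: "\<Union>Th = closure \<Omega>"
    and simplex_Th: "\<And>T. T \<in> Th \<Longrightarrow> int CARD('n) simplex T"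
begin

abbreviation "V \<equiv> P1 \<Omega> Th"
abbreviation "Vd \<equiv> P1_diamond \<Omega> Th"
abbreviation "V0 \<equiv> P1_zero \<Omega> Th"

lemma P1_D:
  assumes "u \<in> V"
  shows "continuous_on (closure \<Omega>) u" "x \<notin> closure \<Omega> \<Longrightarrow> u x = 0" "T \<in> Th \<Longrightarrow> \<exists>a b. \<forall>x\<in>T. u x = a \<bullet> x + b"
  using assms by (simp_all add: P1_def)

lemma function_space_P1: "function_space V"
  unfolding function_space_def
proof (intro conjI ballI allI)
  show "(\<lambda>x. 0) \<in> V"
    unfolding P1_def by (auto intro!: exI[of _ 0])
  fix u v c d assume u: "u \<in> V" and v: "v \<in> V"
  have "\<exists>a b. \<forall>x\<in>T. c * u x + d * v x = a \<bullet> x + b" if T: "T \<in> Th" for T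
  proof -
    obtain a b a' b' where ab: "\<forall>x\<in>T. u x = a \<bullet> x + b" "\<forall>x\<in>T. v x = a' \<bullet> x + b'"
      using P1_D(3)[OF u T] P1_D(3)[OF v T] by blast
    show ?thesis
      by (rule exI[of _ "c *\<^sub>R a + d *\<^sub>R a'"], rule exI[of _ "c * b + d * b'"])
        (simp add: ab inner_add_left algebra_simps)
  qed
  moreover have "continuous_on (closure \<Omega>) (\<lambda>x. c * u x + d * v x)"
    by (intro continuous_intros P1_D(1) u v)
  ultimately show "(\<lambda>x. c * u x + d * v x) \<in> V"
    using P1_D(2)[OF u] P1_D(2)[OF v] by (simp add: P1_def)
qed

lemma P1_continuous_frontier: "u \<in> V \<Longrightarrow> continuous_on (frontier \<Omega>) u"
  using P1_D(1) by (rule continuous_on_subset) (auto simp: frontier_def)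

lemma trace_on_lin: "trace_on \<Omega> (\<lambda>x. c * u x + d * v x) = (\<lambda>x. c * trace_on \<Omega> u x + d * trace_on \<Omega> v x)"
  by (simp add: trace_on_def fun_eq_iff)

lemma integrable_trace:
  assumes "u \<in> V"
  shows "integrable (surface_measure \<Omega>) (trace_on \<Omega> u)"
proof (rule integrable_surface_continuous)
  show "continuous_on (frontier \<Omega>) (trace_on \<Omega> u)"
    using P1_continuous_frontier[OF assms] by (rule continuous_on_eq) (simp add: trace_on_def)
qed

lemma boundary_integral_lin:
  assumes "u \<in> V" "v \<in> V"
  shows "boundary_integral \<Omega> (trace_on \<Omega> (\<lambda>x. c * u x + d * v x)) =
    c * boundary_integral \<Omega> (trace_on \<Omega> u) + d * boundary_integral \<Omega> (trace_on \<Omega> v)"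
  unfolding boundary_integral_def trace_on_lin
  using integrable_trace[OF assms(1)] integrable_trace[OF assms(2)] by simp

lemma trace_zero: "trace_on \<Omega> (\<lambda>x. 0) = (\<lambda>x. 0)"
  by (simp add: trace_on_def fun_eq_iff)

lemma boundary_integral_zero: "boundary_integral \<Omega> (\<lambda>x. 0) = 0"
  by (simp add: boundary_integral_def)

lemma function_space_P1_diamond: "function_space Vd"
  unfolding function_space_def P1_diamond_def
  using function_spaceD[OF function_space_P1]
  by (auto simp: boundary_integral_lin trace_zero boundary_integral_zero)

lemma function_space_P1_zero: "function_space V0"
  unfolding function_space_def P1_zero_def
  using function_spaceD[OF function_space_P1] by (auto simp: trace_on_lin trace_zero)

lemma P1_diamond_subset: "Vd \<subseteq> V"
  by (auto simp: P1_diamond_def)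

lemma P1_zero_subset: "V0 \<subseteq> Vd"
  by (auto simp: P1_diamond_def P1_zero_def boundary_integral_zero)

lemma simplex_facts:
  assumes "T \<in> Th"
  shows "closed T" "convex T" "interior T \<noteq> {}" "T \<subseteq> closure \<Omega>"
proof -
  note S = simplex_Th[OF assms]
  show "closed T" "convex T"
    using simplex_imp_polytope[OF S] polytope_imp_closed polytope_imp_convex by blast+
  have "aff_dim T = int CARD('n)" using aff_dim_simplex[OF S] .
  then have "interior T = rel_interior T" "T \<noteq> {}"
    by (auto simp: interior_rel_interior_gen)
  then show "interior T \<noteq> {}" using rel_interior_eq_empty[OF \<open>convex T\<close>] by simp
  show "T \<subseteq> closure \<Omega>" using assms Union_Th by blast
qed

text \<open>The sum of the gradient norms over the finite mesh serves as common bound; unlike a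
  maximum it needs no nonempty index set.\<close>

lemma P1_gradient_bound:
  assumes u: "u \<in> V"
  shows "\<exists>G\<ge>0. \<forall>T\<in>Th. \<exists>a b. norm a \<le> G \<and> (\<forall>x\<in>T. u x = a \<bullet> x + b)"
proof -
  obtain A where A: "\<And>T. T \<in> Th \<Longrightarrow> \<exists>b. \<forall>x\<in>T. u x = A T \<bullet> x + b"
    using P1_D(3)[OF u] by metis
  show ?thesis
  proof (intro exI[of _ "\<Sum>T\<in>Th. norm (A T)"] conjI ballI)
    show "0 \<le> (\<Sum>T\<in>Th. norm (A T))" by (intro sum_nonneg) auto
    fix T assume T: "T \<in> Th"
    have "norm (A T) \<le> (\<Sum>T\<in>Th. norm (A T))"
      by (rule member_le_sum[OF T]) (auto simp: finite_Th)
    with A[OF T] show "\<exists>a b. norm a \<le> (\<Sum>T\<in>Th. norm (A T)) \<and> (\<forall>x\<in>T. u x = a \<bullet> x + b)" by blast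
  qed
qed

text \<open>The parameters at which the segment runs in a given simplex form a closed set, on which
  \<open>u\<close> is affine with slope at most \<open>M\<close>. Finitely many such sets cover the
  unit interval, and on an interval this gives the Lipschitz bound with the same constant.\<close>

lemma P1_segment_bound:
  assumes G: "0 \<le> G" "\<forall>T\<in>Th. \<exists>a b. norm a \<le> G \<and> (\<forall>x\<in>T. u x = a \<bullet> x + b)"
    and seg: "\<And>t. 0 \<le> t \<Longrightarrow> t \<le> 1 \<Longrightarrow> p + t *\<^sub>R (q - p) \<in> closure \<Omega>"
  shows "\<bar>u p - u q\<bar> \<le> G * norm (p - q)"
proof -
  define \<gamma> where "\<gamma> t = p + t *\<^sub>R (q - p)" for t :: real
  define M where "M = G * norm (q - p)"
  have M: "0 \<le> M" using G(1) by (simp add: M_def)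
  have "M-lipschitz_on {0..1} (\<lambda>t. u (\<gamma> t))"
  proof (rule lipschitz_on_closed_Union[where I=Th and U="\<lambda>T. \<gamma> -` T"])
    fix T assume T: "T \<in> Th"
    show "closed (\<gamma> -` T)"
      unfolding \<gamma>_def by (intro closed_vimage simplex_facts(1)[OF T] continuous_intros)
    obtain a b where ab: "norm a \<le> G" "\<forall>x\<in>T. u x = a \<bullet> x + b" using bspec[OF G(2) T] by blast
    show "M-lipschitz_on (\<gamma> -` T) (\<lambda>t. u (\<gamma> t))"
    proof (rule lipschitz_onI[OF _ M])
      fix s t assume st: "s \<in> \<gamma> -` T" "t \<in> \<gamma> -` T"
      have "u (\<gamma> s) - u (\<gamma> t) = a \<bullet> (\<gamma> s - \<gamma> t)"
        using st ab(2) by (simp add: inner_diff_right)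
      also have "\<gamma> s - \<gamma> t = (s - t) *\<^sub>R (q - p)"
        by (simp add: \<gamma>_def algebra_simps)
      finally have "u (\<gamma> s) - u (\<gamma> t) = (s - t) * (a \<bullet> (q - p))" by simp
      moreover have "\<bar>a \<bullet> (q - p)\<bar> \<le> M"
        using Cauchy_Schwarz_ineq2[of a "q - p"] mult_right_mono[OF ab(1), of "norm (q - p)"] by (simp add: M_def)
      ultimately show "dist (u (\<gamma> s)) (u (\<gamma> t)) \<le> M * dist s t"
        using mult_left_mono[of "\<bar>a \<bullet> (q - p)\<bar>" M "\<bar>s - t\<bar>"] by (simp add: dist_real_def abs_mult mult.commute)
    qed
  next
    show "{0..1} \<subseteq> (\<Union>T\<in>Th. \<gamma> -` T)"
    proof
      fix t :: real assume "t \<in> {0..1}"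
      then have "\<gamma> t \<in> \<Union>Th" using seg[of t] by (simp add: \<gamma>_def Union_Th)
      then show "t \<in> (\<Union>T\<in>Th. \<gamma> -` T)" by blast
    qed
  qed (use M finite_Th in auto)
  then have "dist (u (\<gamma> 0)) (u (\<gamma> 1)) \<le> M * dist 0 (1::real)" by (rule lipschitz_onD) auto
  then show ?thesis by (simp add: \<gamma>_def M_def dist_real_def norm_minus_commute)
qed

text \<open>The closure of \<open>\<Omega>\<close> need not be convex: two boundary points are joined by going down along the chart
  axis, across below the graph, and up again.\<close>

lemma P1_lipschitz_near_frontier:
  assumes G: "0 \<le> G" "\<forall>T\<in>Th. \<exists>a b. norm a \<le> G \<and> (\<forall>x\<in>T. u x = a \<bullet> x + b)"
    and x0: "x0 \<in> frontier \<Omega>"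
  shows "\<exists>r>0. \<exists>C. C-lipschitz_on (cball x0 r \<inter> frontier \<Omega>) u"
proof -
  obtain r R k \<psi> L where chart: "boundary_chart x0 r R k \<psi> L" using lipschitz_chart[OF x0] by blast
  then have r: "0 < r" and L: "0 < L" and R: "orthogonal_transformation R"
    unfolding boundary_chart_def by blast+
  from chart have lip': "\<bar>\<psi> y - \<psi> z\<bar> \<le> L * (\<Sum>i\<in>UNIV - {k}. \<bar>y $ i - z $ i\<bar>)"
    and lip: "\<bar>\<psi> y - \<psi> z\<bar> \<le> L * norm (y - z)" for y z
    unfolding boundary_chart_def by blast+
  from chart have dom: "x \<in> ball x0 r \<Longrightarrow> x \<in> \<Omega> \<longleftrightarrow> R (x - x0) $ k < \<psi> (R (x - x0))"
    and graph: "x \<in> ball x0 r \<Longrightarrow> x \<in> frontier \<Omega> \<Longrightarrow> R (x - x0) $ k = \<psi> (R (x - x0))" for x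
    unfolding boundary_chart_def by blast+
  have lin: "linear R" using R by (rule orthogonal_transformation_linear)
  have norm_R: "norm (R x) = norm x" for x using R by (rule orthogonal_transformation_norm)
  \<comment> \<open>The unit vector that the rotation sends to the chart axis: subtracting multiples
    of it moves down in the chart and leaves \<open>\<psi>\<close> unchanged.\<close>
  define e where "e = inv R (axis k 1)"
  have Re: "R e = axis k 1"
    unfolding e_def by (rule surj_f_inv_f[OF orthogonal_transformation_surj[OF R]])
  have norm_e: "norm e = 1" using norm_R[of e] by (simp add: Re norm_axis_1)
  have shift: "\<psi> (Y - s *\<^sub>R axis k 1) = \<psi> Y" for Y s
  proof -
    have "(\<Sum>i\<in>UNIV - {k}. \<bar>(Y - s *\<^sub>R axis k 1) $ i - Y $ i\<bar>) = 0"
      by (rule sum.neutral) (auto simp: axis_def)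
    then show ?thesis using lip'[of "Y - s *\<^sub>R axis k 1" Y] by simp
  qed
  have below: "z - s *\<^sub>R e \<in> closure \<Omega>"
    if "R (z - x0) $ k - s < \<psi> (R (z - x0))" "z - s *\<^sub>R e \<in> ball x0 r" for z s
  proof -
    have eq: "R (z - s *\<^sub>R e - x0) = R (z - x0) - s *\<^sub>R axis k 1"
      using lin by (simp add: Re[symmetric] linear_diff[OF lin] linear_scale[OF lin])
    have "R (z - s *\<^sub>R e - x0) $ k < \<psi> (R (z - s *\<^sub>R e - x0))"
      using that(1) unfolding eq shift by simp
    then have "z - s *\<^sub>R e \<in> \<Omega>" using dom[OF that(2)] by simp
    then show ?thesis using closure_subset by blast
  qed
  \<comment> \<open>Descending by at most \<open>2 * r' * (L + 1)\<close> from the ball of radius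
    \<open>r'\<close> must stay in the chart:
    \<open>r' * (2 * L + 3) < r' * (2 * L + 4) = r\<close>.\<close>
  define r' where "r' = r / (2 * L + 4)"
  have r': "0 < r'" using r L by (simp add: r'_def)
  have r'r: "r' + 2 * r' * (L + 1) < r"
  proof -
    have "r' * (2 * L + 4) = r" using L by (simp add: r'_def)
    then show ?thesis using r' by (simp add: algebra_simps)
  qed
  have "\<bar>u x - u y\<bar> \<le> G * (2 * L + 3) * norm (x - y)"
    if x: "x \<in> cball x0 r' \<inter> frontier \<Omega>" and y: "y \<in> cball x0 r' \<inter> frontier \<Omega>" and ne: "x \<noteq> y" for x y
  proof -
    \<comment> \<open>The chord from \<open>x\<close> to \<open>y\<close> rises above the graph by
      at most \<open>L * norm (x - y)\<close>; the extra \<open>norm (x - y)\<close> makes the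
      lowered chord lie strictly below.\<close>
    define \<tau> where "\<tau> = (L + 1) * norm (x - y)"
    have dxy: "0 < norm (x - y)" using ne by simp
    have \<tau>: "0 < \<tau>" using dxy L by (simp add: \<tau>_def)
    have "norm (x - y) \<le> 2 * r'"
      using x y dist_triangle3[of x y x0] by (simp add: dist_norm)
    then have "\<tau> \<le> (L + 1) * (2 * r')" unfolding \<tau>_def using L by (intro mult_left_mono) auto
    then have \<tau>r: "r' + \<tau> < r" using r'r by (simp add: algebra_simps)
    have inball: "z - s *\<^sub>R e \<in> ball x0 r" if "z \<in> cball x0 r'" "0 \<le> s" "s \<le> \<tau>" for z s
    proof -
      have "dist x0 (z - s *\<^sub>R e) \<le> dist x0 z + dist z (z - s *\<^sub>R e)" by (rule dist_triangle)
      also have "dist z (z - s *\<^sub>R e) = s" using that norm_e by (simp add: dist_norm)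
      finally show ?thesis using that \<tau>r by simp
    qed
    have graphz: "R (z - x0) $ k = \<psi> (R (z - x0))" if "z \<in> cball x0 r' \<inter> frontier \<Omega>" for z
    proof (rule graph)
      show "z \<in> ball x0 r" using inball[of z 0] that \<tau> by simp
    qed (use that in blast)
    have vertical: "\<bar>u z - u (z - \<tau> *\<^sub>R e)\<bar> \<le> G * \<tau>" if z: "z \<in> cball x0 r' \<inter> frontier \<Omega>" for z
    proof -
      have "z + t *\<^sub>R ((z - \<tau> *\<^sub>R e) - z) \<in> closure \<Omega>" if t: "0 \<le> t" "t \<le> 1" for t
      \<comment> \<open>The top end lies on the graph and not strictly below it, so it is treated
        apart.\<close>
      proof (cases "t = 0")
        case True
        then show ?thesis using z by (simp add: frontier_def)
      next
        case False
        have "z - (t * \<tau>) *\<^sub>R e \<in> closure \<Omega>"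
        proof (rule below)
          show "R (z - x0) $ k - t * \<tau> < \<psi> (R (z - x0))"
            using graphz[OF z] t False \<tau> by simp
          show "z - (t * \<tau>) *\<^sub>R e \<in> ball x0 r"
            using z t \<tau> mult_right_mono[OF t(2), of \<tau>] by (intro inball) auto
        qed
        then show ?thesis by simp
      qed
      from P1_segment_bound[OF G this] have "\<bar>u z - u (z - \<tau> *\<^sub>R e)\<bar> \<le> G * norm (z - (z - \<tau> *\<^sub>R e))" .
      then show ?thesis using \<tau> norm_e by simp
    qed
    have horizontal: "\<bar>u (x - \<tau> *\<^sub>R e) - u (y - \<tau> *\<^sub>R e)\<bar> \<le> G * norm (x - y)"
    proof -
      have "(x - \<tau> *\<^sub>R e) + t *\<^sub>R ((y - \<tau> *\<^sub>R e) - (x - \<tau> *\<^sub>R e)) \<in> closure \<Omega>" if t: "0 \<le> t" "t \<le> 1" for t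
      proof -
        define z where "z = x + t *\<^sub>R (y - x)"
        have z_cball: "z \<in> cball x0 r'"
        proof -
          have "(1 - t) *\<^sub>R x + t *\<^sub>R y \<in> cball x0 r'"
            using x y t by (intro convexD[OF convex_cball]) auto
          then show ?thesis by (simp add: z_def algebra_simps)
        qed
        define X Y Z where "X = R (x - x0)" and "Y = R (y - x0)" and "Z = R (z - x0)"
        have "z - x0 = (x - x0) + t *\<^sub>R ((y - x0) - (x - x0))" by (simp add: z_def)
        then have ZXY: "Z = X + t *\<^sub>R (Y - X)"
          unfolding X_def Y_def Z_def by (simp only: linear_add[OF lin] linear_scale[OF lin] linear_diff[OF lin])
        have nXY: "norm (Y - X) = norm (x - y)"
          unfolding X_def Y_def linear_diff[OF lin, symmetric] norm_R by (simp add: norm_minus_commute)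
        have XZ: "\<psi> X \<le> \<psi> Z + L * norm (x - y)"
        proof -
          have "norm (X - Z) \<le> norm (x - y)"
            using t mult_right_mono[OF t(2), of "norm (Y - X)"] by (simp add: ZXY nXY)
          then have "L * norm (X - Z) \<le> L * norm (x - y)" using L by (intro mult_left_mono) auto
          then show ?thesis using lip[of X Z] by linarith
        qed
        have YZ: "\<psi> Y \<le> \<psi> Z + L * norm (x - y)"
        proof -
          have "Y - Z = (1 - t) *\<^sub>R (Y - X)" by (simp add: ZXY algebra_simps)
          then have "norm (Y - Z) \<le> norm (x - y)"
            using t mult_right_mono[of "1 - t" 1 "norm (Y - X)"] by (simp add: nXY)
          then have "L * norm (Y - Z) \<le> L * norm (x - y)" using L by (intro mult_left_mono) auto
          then show ?thesis using lip[of Y Z] by linarith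
        qed
        have "Z $ k = (1 - t) * \<psi> X + t * \<psi> Y"
          using graphz[OF x] graphz[OF y] unfolding X_def[symmetric] Y_def[symmetric]
          by (simp add: ZXY algebra_simps)
        also have "\<dots> \<le> (1 - t) * (\<psi> Z + L * norm (x - y)) + t * (\<psi> Z + L * norm (x - y))"
          using XZ YZ t by (intro add_mono mult_left_mono) auto
        also have "\<dots> = \<psi> Z + L * norm (x - y)" by (simp add: algebra_simps)
        also have "\<dots> < \<psi> Z + \<tau>" using dxy by (simp add: \<tau>_def algebra_simps)
        finally have "R (z - x0) $ k - \<tau> < \<psi> (R (z - x0))" by (simp add: Z_def)
        then have "z - \<tau> *\<^sub>R e \<in> closure \<Omega>"
          using inball[OF z_cball] \<tau> by (intro below) auto
        then show ?thesis by (simp add: z_def algebra_simps)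
      qed
      from P1_segment_bound[OF G this] have "\<bar>u (x - \<tau> *\<^sub>R e) - u (y - \<tau> *\<^sub>R e)\<bar> \<le> G * norm ((x - \<tau> *\<^sub>R e) - (y - \<tau> *\<^sub>R e))" .
      then show ?thesis by simp
    qed
    \<comment> \<open>Two vertical legs of length \<open>\<tau>\<close> and one leg across:
      \<open>2 * (L + 1) + 1 = 2 * L + 3\<close>.\<close>
    have "\<bar>u x - u y\<bar> \<le> G * \<tau> + G * norm (x - y) + G * \<tau>"
      using vertical[OF x] vertical[OF y] horizontal by linarith
    also have "\<dots> = G * (2 * L + 3) * norm (x - y)" by (simp add: \<tau>_def algebra_simps)
    finally show ?thesis .
  qed
  then have main: "dist (u x) (u y) \<le> G * (2 * L + 3) * dist x y"
    if "x \<in> cball x0 r' \<inter> frontier \<Omega>" "y \<in> cball x0 r' \<inter> frontier \<Omega>" for x y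
    using that by (cases "x = y") (simp_all add: dist_norm)
  have "(G * (2 * L + 3))-lipschitz_on (cball x0 r' \<inter> frontier \<Omega>) u"
    using G(1) L by (intro lipschitz_onI main) auto
  with r' show ?thesis by blast
qed

text \<open>On a compact set local Lipschitz continuity is global. \<open>local_lipschitz\<close>
  speaks of families of functions, so \<open>u\<close> is viewed as a family over the single
  parameter 0.\<close>

lemma P1_lipschitz_frontier:
  assumes u: "u \<in> V"
  obtains C where "C-lipschitz_on (frontier \<Omega>) u"
proof -
  obtain G where G: "0 \<le> G" "\<forall>T\<in>Th. \<exists>a b. norm a \<le> G \<and> (\<forall>x\<in>T. u x = a \<bullet> x + b)"
    using P1_gradient_bound[OF u] by blast
  have "local_lipschitz {0::real} (frontier \<Omega>) (\<lambda>_. u)"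
    unfolding local_lipschitz_def
  proof (intro ballI)
    fix x t assume "x \<in> frontier \<Omega>"
    from P1_lipschitz_near_frontier[OF G this] obtain r C where "0 < r" "C-lipschitz_on (cball x r \<inter> frontier \<Omega>) u"
      by blast
    then show "\<exists>r>0. \<exists>C. \<forall>t\<in>cball t r \<inter> {0::real}. C-lipschitz_on (cball x r \<inter> frontier \<Omega>) u" by blast
  qed
  then show thesis
  proof (rule local_lipschitz_compact_implies_lipschitz[OF _ compact_frontier_dom])
    fix C assume "\<And>t. t \<in> {0::real} \<Longrightarrow> C-lipschitz_on (frontier \<Omega>) u"
    then have "C-lipschitz_on (frontier \<Omega>) u" by simp
    then show thesis by (rule that)
  qed simp_all
qed

lemma trace_in_H_half:
  assumes u: "u \<in> V"
  shows "trace_on \<Omega> u \<in> H_half \<Omega>"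
proof -
  obtain C where "C-lipschitz_on (frontier \<Omega>) u" by (rule P1_lipschitz_frontier[OF u])
  then have "C-lipschitz_on (frontier \<Omega>) (trace_on \<Omega> u)"
    by (simp add: lipschitz_on_def trace_on_def)
  then show ?thesis by (rule lipschitz_in_H_half)
qed

end

section \<open>Gradients and the energy form\<close>

lemma grad_eqI:
  fixes u :: "real^'n \<Rightarrow> real"
  assumes "(u has_derivative (\<lambda>y. a \<bullet> y)) (at x)"
  shows "grad u x = a"
proof -
  have "(u has_derivative (\<lambda>y. grad u x \<bullet> y)) (at x)"
    unfolding grad_def by (rule someI[of "\<lambda>g. (u has_derivative (\<lambda>y. g \<bullet> y)) (at x)", OF assms])
  then have "(\<lambda>y. grad u x \<bullet> y) = (\<lambda>y. a \<bullet> y)" using assms by (rule has_derivative_unique)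
  then have "\<forall>y. y \<bullet> grad u x = y \<bullet> a" by (metis inner_commute)
  then show ?thesis by (simp only: vector_eq_ldot)
qed

lemma grad_on_piece:
  fixes u :: "real^'n \<Rightarrow> real"
  assumes "\<forall>x\<in>T. u x = a \<bullet> x + b" "x \<in> interior T"
  shows "(u has_derivative (\<lambda>y. a \<bullet> y)) (at x)" "grad u x = a"
proof -
  have "((\<lambda>x. a \<bullet> x + b) has_derivative (\<lambda>y. a \<bullet> y)) (at x)"
    by (auto intro!: derivative_eq_intros)
  then show "(u has_derivative (\<lambda>y. a \<bullet> y)) (at x)"
    by (rule has_derivative_transform_within_open[OF _ open_interior assms(2)])
      (use assms(1) interior_subset[of T] in auto)
  then show "grad u x = a" by (rule grad_eqI)
qed

text \<open>The coefficient assumptions are entrywise, so measurability and integrability of the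
  flux are checked on this expansion.\<close>

lemma flux_eq: "(A *v a) \<bullet> b = (\<Sum>r\<in>UNIV. \<Sum>s\<in>UNIV. A $ r $ s * a $ s * b $ r)"
  for A :: "real^'n^'n"
  by (simp add: inner_vec_def matrix_vector_mult_def sum_distrib_right)

context fem_setting
begin

abbreviation "LO \<equiv> lebesgue_on \<Omega>"

lemma lmeasurable_dom: "\<Omega> \<in> lmeasurable"
  using bounded_dom open_dom by (simp add: bounded_set_imp_lmeasurable)

lemma dom_sets [measurable, simp]: "\<Omega> \<in> sets lebesgue"
  using open_dom by simp

lemma finite_measure_dom: "finite_measure LO"
  using lmeasurable_dom by (rule finite_measure_lebesgue_on)

lemma P1_has_grad:
  assumes u: "u \<in> V" and x: "x \<in> \<Union>(interior ` Th)"
  shows "(u has_derivative (\<lambda>y. grad u x \<bullet> y)) (at x)"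
proof -
  obtain T where T: "T \<in> Th" "x \<in> interior T" using x by blast
  obtain a b where "\<forall>x\<in>T. u x = a \<bullet> x + b" using P1_D(3)[OF u T(1)] by blast
  from grad_on_piece[OF this T(2)] show ?thesis by simp
qed

lemma grad_lin:
  assumes u: "u \<in> V" and v: "v \<in> V" and x: "x \<in> \<Union>(interior ` Th)"
  shows "grad (\<lambda>x. c * u x + d * v x) x = c *\<^sub>R grad u x + d *\<^sub>R grad v x"
proof (rule grad_eqI)
  have "((\<lambda>x. c * u x + d * v x) has_derivative (\<lambda>y. c * (grad u x \<bullet> y) + d * (grad v x \<bullet> y))) (at x)"
    by (intro has_derivative_add has_derivative_mult_right P1_has_grad u v x)
  then show "((\<lambda>x. c * u x + d * v x) has_derivative (\<lambda>y. (c *\<^sub>R grad u x + d *\<^sub>R grad v x) \<bullet> y)) (at x)"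
    by (simp add: inner_add_left)
qed

lemma negligible_skeleton: "negligible (\<Omega> - \<Union>(interior ` Th))"
proof (rule negligible_subset)
  show "negligible (\<Union>T\<in>Th. frontier T)"
    using finite_Th simplex_facts(2) by (intro negligible_Union) (auto intro: negligible_convex_frontier)
  show "\<Omega> - \<Union>(interior ` Th) \<subseteq> (\<Union>T\<in>Th. frontier T)"
  proof
    fix x assume x: "x \<in> \<Omega> - \<Union>(interior ` Th)"
    then have "x \<in> \<Union>Th" using Union_Th closure_subset by blast
    then obtain T where T: "T \<in> Th" "x \<in> T" by blast
    then have "x \<in> frontier T" using x closure_subset by (auto simp: frontier_def)
    with T(1) show "x \<in> (\<Union>T\<in>Th. frontier T)" by blast
  qed
qed

lemma AE_in_pieces: "AE x in LO. x \<in> \<Union>(interior ` Th)"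
proof (rule AE_I')
  show "\<Omega> - \<Union>(interior ` Th) \<in> null_sets LO"
    using negligible_skeleton by (simp add: null_sets_restrict_space negligible_iff_null_sets)
  show "{x \<in> space LO. x \<notin> \<Union>(interior ` Th)} \<subseteq> \<Omega> - \<Union>(interior ` Th)"
    by auto
qed

text \<open>Inside each simplex the gradient is constant. On the skeleton \<open>grad\<close> may be
  an arbitrary choice, but by completeness of Lebesgue measure every subset of that negligible set
  is measurable.\<close>

lemma measurable_grad [measurable]:
  assumes u: "u \<in> V"
  shows "(\<lambda>x. grad u x $ i) \<in> borel_measurable LO"
proof (rule measurable_piecewise_restrict)
  let ?C = "insert (\<Omega> - \<Union>(interior ` Th)) (interior ` Th)"
  show "countable ?C" using finite_Th by (intro countable_finite) simp
  show "space LO \<subseteq> \<Union>?C" by auto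
  have N: "negligible A" if "A \<subseteq> \<Omega> - \<Union>(interior ` Th)" for A
    using negligible_skeleton that by (rule negligible_subset)
  fix S assume S: "S \<in> ?C"
  show "S \<inter> space LO \<in> sets LO"
  proof (cases "S \<in> interior ` Th")
    case True
    then have "open S" by auto
    then have "S \<in> sets lebesgue" by simp
    then show ?thesis by (auto simp: sets_restrict_space)
  next
    case False
    with S have "S = \<Omega> - \<Union>(interior ` Th)" by blast
    then have "negligible (S \<inter> \<Omega>)" by (intro N) blast
    then have "S \<inter> \<Omega> \<in> sets lebesgue" by (rule negligible_imp_sets)
    then have "(S \<inter> \<Omega>) \<inter> \<Omega> \<in> sets LO" by (auto simp: sets_restrict_space)
    then show ?thesis by simp
  qed
  show "(\<lambda>x. grad u x $ i) \<in> borel_measurable (restrict_space LO S)"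
  proof (cases "S \<in> interior ` Th")
    case True
    then obtain T where T: "T \<in> Th" "S = interior T" by blast
    obtain a b where ab: "\<forall>x\<in>T. u x = a \<bullet> x + b" using P1_D(3)[OF u T(1)] by blast
    have "grad u x $ i = a $ i" if "x \<in> space (restrict_space LO S)" for x
      using grad_on_piece(2)[OF ab] that T(2) by (simp add: space_restrict_space)
    from measurable_cong[of "restrict_space LO S" "\<lambda>x. grad u x $ i" "\<lambda>_. a $ i", OF this]
    show ?thesis by simp
  next
    case False
    with S have S: "S = \<Omega> - \<Union>(interior ` Th)" by blast
    show ?thesis
    proof (rule measurableI)
      fix B :: "real set" assume "B \<in> sets borel"
      let ?A = "(\<lambda>x. grad u x $ i) -` B \<inter> space (restrict_space LO S)"
      have sub: "?A \<subseteq> S" "?A \<subseteq> \<Omega>" by (auto simp: space_restrict_space)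
      have "negligible ?A" using sub(1) S by (intro N) simp
      then have "?A \<in> sets lebesgue" by (rule negligible_imp_sets)
      then have "?A \<inter> \<Omega> \<inter> S \<in> sets (restrict_space LO S)"
        by (auto simp: sets_restrict_space)
      moreover have "?A \<inter> \<Omega> \<inter> S = ?A" using sub by blast
      ultimately show "?A \<in> sets (restrict_space LO S)" by simp
    qed simp
  qed
qed

lemma measurable_Q [measurable]: "(\<lambda>x. Q x $ r $ s) \<in> borel_measurable LO"
  using coeff unfolding admissible_coefficient_def by blast

lemma grad_bounded:
  assumes u: "u \<in> V"
  shows "\<exists>G\<ge>0. \<forall>x\<in>\<Union>(interior ` Th). norm (grad u x) \<le> G"
proof -
  obtain G where G: "0 \<le> G" "\<forall>T\<in>Th. \<exists>a b. norm a \<le> G \<and> (\<forall>x\<in>T. u x = a \<bullet> x + b)"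
    using P1_gradient_bound[OF u] by blast
  have "norm (grad u x) \<le> G" if x: "x \<in> \<Union>(interior ` Th)" for x
  proof -
    obtain T where T: "T \<in> Th" "x \<in> interior T" using x by blast
    obtain a b where ab: "norm a \<le> G" "\<forall>x\<in>T. u x = a \<bullet> x + b" using bspec[OF G(2) T(1)] by blast
    then show ?thesis using grad_on_piece(2)[OF ab(2) T(2)] by simp
  qed
  with G(1) show ?thesis by blast
qed

lemma integrable_flux:
  assumes u: "u \<in> V" and v: "v \<in> V"
  shows "integrable LO (\<lambda>x. (Q x *v grad u x) \<bullet> grad v x)"
proof -
  interpret finite_measure LO by (rule finite_measure_dom)
  obtain M where M: "\<And>r s. AE x in LO. \<bar>Q x $ r $ s\<bar> \<le> M"
    using coeff unfolding admissible_coefficient_def by blast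
  obtain G where G: "0 \<le> G" "\<forall>x\<in>\<Union>(interior ` Th). norm (grad u x) \<le> G"
    using grad_bounded[OF u] by blast
  obtain H where H: "0 \<le> H" "\<forall>x\<in>\<Union>(interior ` Th). norm (grad v x) \<le> H"
    using grad_bounded[OF v] by blast
  have "integrable LO (\<lambda>x. Q x $ r $ s * grad u x $ s * grad v x $ r)" for r s
  proof (rule integrable_const_bound[where B="\<bar>M\<bar> * G * H"])
    show "(\<lambda>x. Q x $ r $ s * grad u x $ s * grad v x $ r) \<in> borel_measurable LO"
      using u v by measurable
    show "AE x in LO. norm (Q x $ r $ s * grad u x $ s * grad v x $ r) \<le> \<bar>M\<bar> * G * H"
      using M[of r s] AE_in_pieces
    proof eventually_elim
      fix x assume x: "\<bar>Q x $ r $ s\<bar> \<le> M" "x \<in> \<Union>(interior ` Th)"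
      have "\<bar>grad u x $ s\<bar> \<le> G" using component_le_norm_cart[of "grad u x" s] bspec[OF G(2) x(2)] by linarith
      moreover have "\<bar>grad v x $ r\<bar> \<le> H" using component_le_norm_cart[of "grad v x" r] bspec[OF H(2) x(2)] by linarith
      moreover have "\<bar>Q x $ r $ s\<bar> \<le> \<bar>M\<bar>" using x(1) by linarith
      ultimately have "\<bar>Q x $ r $ s\<bar> * \<bar>grad u x $ s\<bar> * \<bar>grad v x $ r\<bar> \<le> \<bar>M\<bar> * G * H"
        using G(1) by (intro mult_mono) auto
      then show "norm (Q x $ r $ s * grad u x $ s * grad v x $ r) \<le> \<bar>M\<bar> * G * H"
        by (simp add: abs_mult)
    qed
  qed
  then show ?thesis unfolding flux_eq by (intro Bochner_Integration.integrable_sum)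
qed

lemma energy_lin:
  assumes u: "u \<in> V" and v: "v \<in> V" and w: "w \<in> V"
  shows "energy \<Omega> Q w (\<lambda>x. c * u x + d * v x) = c * energy \<Omega> Q w u + d * energy \<Omega> Q w v"
proof -
  have "energy \<Omega> Q w (\<lambda>x. c * u x + d * v x)
      = integral\<^sup>L LO (\<lambda>x. c * ((Q x *v grad w x) \<bullet> grad u x) + d * ((Q x *v grad w x) \<bullet> grad v x))"
    unfolding energy_def
  proof (rule integral_cong_AE)
    show "(\<lambda>x. (Q x *v grad w x) \<bullet> grad (\<lambda>x. c * u x + d * v x) x) \<in> borel_measurable LO"
      by (intro borel_measurable_integrable integrable_flux w function_spaceD(2)[OF function_space_P1] u v)
    show "(\<lambda>x. c * ((Q x *v grad w x) \<bullet> grad u x) + d * ((Q x *v grad w x) \<bullet> grad v x)) \<in> borel_measurable LO"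
      using integrable_flux[OF w u] integrable_flux[OF w v] by (intro borel_measurable_add borel_measurable_times) auto
    show "AE x in LO. (Q x *v grad w x) \<bullet> grad (\<lambda>x. c * u x + d * v x) x
        = c * ((Q x *v grad w x) \<bullet> grad u x) + d * ((Q x *v grad w x) \<bullet> grad v x)"
      using AE_in_pieces by eventually_elim (simp only: grad_lin[OF u v] inner_add_right inner_scaleR_right)
  qed
  also have "\<dots> = c * energy \<Omega> Q w u + d * energy \<Omega> Q w v"
    unfolding energy_def using integrable_flux[OF w u] integrable_flux[OF w v] by simp
  finally show ?thesis .
qed

lemma energy_sym:
  assumes u: "u \<in> V" and v: "v \<in> V"
  shows "energy \<Omega> Q u v = energy \<Omega> Q v u"
  unfolding energy_def
proof (rule integral_cong_AE)
  have "AE x in LO. transpose (Q x) = Q x"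
    using coeff unfolding admissible_coefficient_def by blast
  then show "AE x in LO. (Q x *v grad u x) \<bullet> grad v x = (Q x *v grad v x) \<bullet> grad u x"
  proof eventually_elim
    fix x assume "transpose (Q x) = Q x"
    then show "(Q x *v grad u x) \<bullet> grad v x = (Q x *v grad v x) \<bullet> grad u x"
      by (metis dot_lmul_matrix inner_commute transpose_matrix_vector)
  qed
qed (intro borel_measurable_integrable integrable_flux u v)+

lemma energy_pos:
  assumes u: "u \<in> V"
  shows "0 \<le> energy \<Omega> Q u u"
    and "energy \<Omega> Q u u = 0 \<Longrightarrow> AE x in LO. grad u x = 0"
proof -
  have qlow: "0 < qlow" and ell: "AE x in LO. \<forall>\<xi>. (Q x *v \<xi>) \<bullet> \<xi> \<ge> qlow * (norm \<xi>)\<^sup>2"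
    using coeff unfolding admissible_coefficient_def by blast+
  have nonneg: "AE x in LO. 0 \<le> (Q x *v grad u x) \<bullet> grad u x"
    using ell
  proof eventually_elim
    fix x assume "\<forall>\<xi>. (Q x *v \<xi>) \<bullet> \<xi> \<ge> qlow * (norm \<xi>)\<^sup>2"
    then have "qlow * (norm (grad u x))\<^sup>2 \<le> (Q x *v grad u x) \<bullet> grad u x" by blast
    moreover have "0 \<le> qlow * (norm (grad u x))\<^sup>2" using qlow by simp
    ultimately show "0 \<le> (Q x *v grad u x) \<bullet> grad u x" by linarith
  qed
  show "0 \<le> energy \<Omega> Q u u"
    unfolding energy_def using nonneg by (rule integral_nonneg_AE)
  assume "energy \<Omega> Q u u = 0"
  then have "AE x in LO. (Q x *v grad u x) \<bullet> grad u x = 0"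
    unfolding energy_def using integral_nonneg_eq_0_iff_AE[OF integrable_flux[OF u u] nonneg] by blast
  with ell show "AE x in LO. grad u x = 0"
  proof eventually_elim
    fix x assume x: "\<forall>\<xi>. (Q x *v \<xi>) \<bullet> \<xi> \<ge> qlow * (norm \<xi>)\<^sup>2" "(Q x *v grad u x) \<bullet> grad u x = 0"
    then have "qlow * (norm (grad u x))\<^sup>2 \<le> 0" by metis
    then show "grad u x = 0" using qlow by (simp add: mult_le_0_iff)
  qed
qed

text \<open>Each simplex meets \<open>\<Omega>\<close> in a set with nonempty interior, hence not
  negligible, so its slope vanishes. Then \<open>u\<close> takes finitely many values on the
  connected closure, and continuity leaves only one.\<close>

lemma grad_zero_constant:
  assumes u: "u \<in> V" and AE: "AE x in LO. grad u x = 0"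
  shows "\<exists>c. \<forall>x\<in>closure \<Omega>. u x = c"
proof -
  have const: "\<exists>c. \<forall>x\<in>T. u x = c" if T: "T \<in> Th" for T
  proof -
    obtain a b where ab: "\<forall>x\<in>T. u x = a \<bullet> x + b" using P1_D(3)[OF u T] by blast
    have "interior T \<inter> closure \<Omega> \<noteq> {}" using simplex_facts(3,4)[OF T] interior_subset[of T] by blast
    then have ne: "interior T \<inter> \<Omega> \<noteq> {}" using open_Int_closure_eq_empty[OF open_interior] by blast
    have "a = 0"
    proof (rule ccontr)
      assume "a \<noteq> 0"
      obtain N where "{x \<in> space LO. grad u x \<noteq> 0} \<subseteq> N" "emeasure LO N = 0" "N \<in> sets LO"
        using AE by (rule AE_E)
      then have N: "{x \<in> space LO. grad u x \<noteq> 0} \<subseteq> N" "N \<in> null_sets LO" by (auto intro: null_setsI)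
      have "interior T \<inter> \<Omega> \<subseteq> N"
        using grad_on_piece(2)[OF ab] \<open>a \<noteq> 0\<close> N(1) by auto
      moreover have "negligible N"
        using N(2) by (simp add: null_sets_restrict_space negligible_iff_null_sets)
      ultimately have "negligible (interior T \<inter> \<Omega>)" using negligible_subset by blast
      then show False using ne open_not_negligible[of "interior T \<inter> \<Omega>"] open_dom by blast
    qed
    then show ?thesis using ab by auto
  qed
  have "finite (u ` closure \<Omega>)"
  proof -
    obtain c where c: "\<And>T. T \<in> Th \<Longrightarrow> \<forall>x\<in>T. u x = c T" using const by metis
    have "u ` closure \<Omega> \<subseteq> c ` Th"
    proof
      fix y assume "y \<in> u ` closure \<Omega>"
      then obtain x T where "y = u x" "x \<in> T" "T \<in> Th" using Union_Th by blast
      then show "y \<in> c ` Th" using c by blast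
    qed
    then show ?thesis using finite_Th by (meson finite_imageI finite_subset)
  qed
  then have "u constant_on closure \<Omega>"
    using connected_dom by (intro continuous_finite_range_constant connected_imp_connected_closure P1_D(1) u)
  then show ?thesis by (auto simp: constant_on_def)
qed

lemma symmetric_energy: "symmetric_form V (energy \<Omega> Q)"
  unfolding symmetric_form_def linear_form_def using energy_lin energy_sym by blast

text \<open>Zero energy leaves a constant \<open>c\<close> on the closure, and its boundary integral
  is \<open>c\<close> times the positive surface measure. Off the closure \<open>P1\<close>
  functions are 0 by definition, so equality holds on the whole space, as
  \<open>definite_form\<close> demands.\<close>

lemma definite_energy: "definite_form Vd (energy \<Omega> Q)"
  unfolding definite_form_def
proof (intro conjI ballI impI)
  show "symmetric_form Vd (energy \<Omega> Q)"
    by (rule symmetric_form_subset[OF symmetric_energy P1_diamond_subset])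
  fix u assume "u \<in> Vd"
  then have u: "u \<in> V" and int: "boundary_integral \<Omega> (trace_on \<Omega> u) = 0"
    by (auto simp: P1_diamond_def)
  show "0 \<le> energy \<Omega> Q u u" by (rule energy_pos(1)[OF u])
  assume "energy \<Omega> Q u u = 0"
  from grad_zero_constant[OF u energy_pos(2)[OF u this]] obtain c where c: "\<forall>x\<in>closure \<Omega>. u x = c" ..
  have "boundary_integral \<Omega> (trace_on \<Omega> u) = integral\<^sup>L (surface_measure \<Omega>) (\<lambda>x. c)"
    unfolding boundary_integral_def using c
    by (intro Bochner_Integration.integral_cong) (auto simp: trace_on_def frontier_def)
  also have "\<dots> = c * measure (surface_measure \<Omega>) (frontier \<Omega>)" by simp
  finally have "c = 0" using int surface_measure_pos by simp
  then show "u = (\<lambda>x. 0)" using c P1_D(2)[OF u] by (metis ext)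
qed

lemma definite_energy_zero: "definite_form V0 (energy \<Omega> Q)"
  by (rule definite_form_subset[OF definite_energy P1_zero_subset])

text \<open>The points come from finite sets whose convex hulls are the simplices: an affine
  function vanishing on such a set vanishes on the hull. This is the finite dimension required by
  \<open>riesz_finite\<close>.\<close>

lemma determining_points:
  "\<exists>P. finite P \<and> (\<forall>u\<in>V. (\<forall>p\<in>P. u p = 0) \<longrightarrow> u = (\<lambda>x. 0))"
proof -
  have "\<forall>T\<in>Th. \<exists>C. finite C \<and> T = convex hull C"
    using simplex_Th simplex_imp_polytope unfolding polytope_def by blast
  then obtain C where C: "\<And>T. T \<in> Th \<Longrightarrow> finite (C T) \<and> T = convex hull (C T)" by metis
  have "u = (\<lambda>x. 0)" if u: "u \<in> V" and z: "\<forall>p\<in>\<Union>(C ` Th). u p = 0" for u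
  proof
    fix x
    show "u x = 0"
    proof (cases "x \<in> closure \<Omega>")
      case True
      then obtain T where T: "T \<in> Th" "x \<in> T" using Union_Th by blast
      obtain a b where ab: "\<forall>x\<in>T. u x = a \<bullet> x + b" using P1_D(3)[OF u T(1)] by blast
      have hull: "T = convex hull (C T)" using C[OF T(1)] by simp
      have "C T \<subseteq> T" by (subst hull) (rule hull_subset)
      then have "C T \<subseteq> {y. a \<bullet> y = - b}" using z ab T(1) by force
      then have "convex hull (C T) \<subseteq> {y. a \<bullet> y = - b}"
        by (rule hull_minimal) (rule convex_hyperplane)
      then have "a \<bullet> x = - b" using T(2) hull by blast
      then show ?thesis using ab T(2) by simp
    qed (rule P1_D(2)[OF u])
  qed
  moreover have "finite (\<Union>(C ` Th))" using C finite_Th by blast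
  ultimately show ?thesis by blast
qed

lemma P1_in_L2:
  assumes u: "u \<in> V"
  shows "u \<in> L2 \<Omega>"
proof -
  interpret finite_measure LO by (rule finite_measure_dom)
  have cont: "continuous_on \<Omega> u" using P1_D(1)[OF u] closure_subset by (rule continuous_on_subset)
  then have meas: "u \<in> borel_measurable LO"
    by (rule continuous_imp_measurable_on_sets_lebesgue) simp
  have "compact (closure \<Omega>)" using bounded_dom by simp
  then have "bounded (u ` closure \<Omega>)"
    using P1_D(1)[OF u] by (intro compact_imp_bounded compact_continuous_image)
  then obtain B where B: "\<And>x. x \<in> closure \<Omega> \<Longrightarrow> \<bar>u x\<bar> \<le> B" by (auto simp: bounded_iff)
  have "(u x)\<^sup>2 \<le> B\<^sup>2" if "x \<in> \<Omega>" for x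
    using B[of x] that closure_subset by (metis abs_ge_zero power2_abs power_mono subsetD)
  then have "integrable LO (\<lambda>x. (u x)\<^sup>2)"
    using meas by (intro integrable_const_bound[where B="B\<^sup>2"]) auto
  with meas show ?thesis by (simp add: L2_def)
qed

end

section \<open>The L2 inner product\<close>

lemma integrable_L2_mult:
  fixes \<Omega> :: "(real^'n) set"
  assumes "f \<in> L2 \<Omega>" "g \<in> L2 \<Omega>"
  shows "integrable (lebesgue_on \<Omega>) (\<lambda>x. f x * g x)"
proof (rule Bochner_Integration.integrable_bound)
  show "integrable (lebesgue_on \<Omega>) (\<lambda>x. (f x)\<^sup>2 + (g x)\<^sup>2)"
    using assms by (simp add: L2_def)
  show "(\<lambda>x. f x * g x) \<in> borel_measurable (lebesgue_on \<Omega>)"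
    using assms by (intro borel_measurable_times) (simp_all add: L2_def)
  have "\<bar>a * b\<bar> \<le> a\<^sup>2 + b\<^sup>2" for a b :: real
  proof -
    have "2 * \<bar>a\<bar> * \<bar>b\<bar> \<le> a\<^sup>2 + b\<^sup>2" using sum_squares_bound[of "\<bar>a\<bar>" "\<bar>b\<bar>"] by simp
    moreover have "0 \<le> \<bar>a\<bar> * \<bar>b\<bar>" by simp
    ultimately show ?thesis unfolding abs_mult by linarith
  qed
  then show "AE x in lebesgue_on \<Omega>. norm (f x * g x) \<le> norm ((f x)\<^sup>2 + (g x)\<^sup>2)"
    by (intro AE_I2) (simp add: order_trans[OF _ abs_ge_self])
qed

lemma function_space_L2: "function_space (L2 (\<Omega> :: (real^'n) set))"
  unfolding function_space_def
proof (intro conjI ballI allI)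
  show "(\<lambda>x. 0) \<in> L2 \<Omega>" by (simp add: L2_def)
  fix u v :: "real^'n \<Rightarrow> real" and a b :: real assume u: "u \<in> L2 \<Omega>" and v: "v \<in> L2 \<Omega>"
  have "(\<lambda>x. (a * u x + b * v x)\<^sup>2) = (\<lambda>x. a\<^sup>2 * (u x)\<^sup>2 + b\<^sup>2 * (v x)\<^sup>2 + 2 * a * b * (u x * v x))"
    by (simp add: fun_eq_iff power2_eq_square algebra_simps)
  moreover have "integrable (lebesgue_on \<Omega>) (\<lambda>x. a\<^sup>2 * (u x)\<^sup>2 + b\<^sup>2 * (v x)\<^sup>2 + 2 * a * b * (u x * v x))"
    using u v integrable_L2_mult[OF u v] by (simp add: L2_def)
  moreover have "(\<lambda>x. a * u x + b * v x) \<in> borel_measurable (lebesgue_on \<Omega>)"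
    using u v by (intro borel_measurable_add borel_measurable_times) (simp_all add: L2_def)
  ultimately show "(\<lambda>x. a * u x + b * v x) \<in> L2 \<Omega>"
    by (simp add: L2_def)
qed

lemma symmetric_L2_inner: "symmetric_form (L2 (\<Omega> :: (real^'n) set)) (L2_inner \<Omega>)"
  unfolding symmetric_form_def linear_form_def
proof (intro conjI ballI allI)
  fix u v w :: "real^'n \<Rightarrow> real" and a b :: real assume u: "u \<in> L2 \<Omega>" and v: "v \<in> L2 \<Omega>" and w: "w \<in> L2 \<Omega>"
  have "(\<lambda>x. w x * (a * u x + b * v x)) = (\<lambda>x. a * (w x * u x) + b * (w x * v x))"
    by (simp add: fun_eq_iff algebra_simps)
  then show "L2_inner \<Omega> w (\<lambda>x. a * u x + b * v x) = a * L2_inner \<Omega> w u + b * L2_inner \<Omega> w v"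
    unfolding L2_inner_def using integrable_L2_mult[OF w u] integrable_L2_mult[OF w v] by simp
next
  fix u v :: "real^'n \<Rightarrow> real"
  show "L2_inner \<Omega> u v = L2_inner \<Omega> v u" by (simp add: L2_inner_def mult.commute)
qed

lemma L2_inner_self_nonneg: "0 \<le> L2_inner \<Omega> f f"
  unfolding L2_inner_def by (intro Bochner_Integration.integral_nonneg) simp

section \<open>The regularized minimization problem\<close>

context fem_setting
begin

lemma galerkin_solution:
  assumes W: "W \<subseteq> Vd" "function_space W" and B: "definite_form W B" and l: "linear_form W l"
  shows "\<exists>u\<in>W. \<forall>v\<in>W. B u v = l v"
proof -
  obtain P where P: "finite P" "\<forall>u\<in>V. (\<forall>p\<in>P. u p = 0) \<longrightarrow> u = (\<lambda>x. 0)"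
    using determining_points by blast
  show ?thesis
  proof (rule riesz_finite[OF P(1) W(2) B l])
    fix u assume "u \<in> W" "\<And>p. p \<in> P \<Longrightarrow> u p = 0"
    then show "u = (\<lambda>x. 0)" using P(2) W(1) P1_diamond_subset by blast
  qed
qed

lemma linear_form_load:
  assumes f: "f \<in> L2 \<Omega>"
  shows "linear_form V (L2_inner \<Omega> f)"
proof -
  have "linear_form (L2 \<Omega>) (L2_inner \<Omega> f)"
    using symmetric_L2_inner f unfolding symmetric_form_def by blast
  moreover have "V \<subseteq> L2 \<Omega>" using P1_in_L2 by blast
  ultimately show ?thesis by (rule linear_form_subset)
qed

lemma linear_form_trace:
  assumes j: "j \<in> H_minus_half \<Omega>"
  shows "linear_form V (\<lambda>v. j (trace_on \<Omega> v))"
  unfolding linear_form_def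
proof (intro ballI allI)
  fix u v a b assume "u \<in> V" "v \<in> V"
  then have "trace_on \<Omega> u \<in> H_half \<Omega>" "trace_on \<Omega> v \<in> H_half \<Omega>" by (simp_all add: trace_in_H_half)
  then show "j (trace_on \<Omega> (\<lambda>x. a * u x + b * v x)) = a * j (trace_on \<Omega> u) + b * j (trace_on \<Omega> v)"
    using j unfolding H_minus_half_def trace_on_lin by blast
qed

text \<open>Existence from \<open>galerkin_solution\<close> and uniqueness from definiteness on
  \<open>Vd\<close> justify the \<open>THE\<close> in the definition.\<close>

lemma Neumann_h_solves:
  assumes f: "f \<in> L2 \<Omega>" and j: "j \<in> H_minus_half \<Omega>"
  shows "Neumann_h \<Omega> Q Th f j \<in> Vd"
    and "\<phi> \<in> Vd \<Longrightarrow> energy \<Omega> Q (Neumann_h \<Omega> Q Th f j) \<phi> = L2_inner \<Omega> f \<phi> + j (trace_on \<Omega> \<phi>)"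
proof -
  let ?P = "\<lambda>u. u \<in> Vd \<and> (\<forall>\<phi>\<in>Vd. energy \<Omega> Q u \<phi> = L2_inner \<Omega> f \<phi> + j (trace_on \<Omega> \<phi>))"
  have "linear_form V (\<lambda>\<phi>. 1 * L2_inner \<Omega> f \<phi> + 1 * j (trace_on \<Omega> \<phi>))"
    by (intro linear_form_add linear_form_load linear_form_trace f j)
  then have "linear_form Vd (\<lambda>\<phi>. L2_inner \<Omega> f \<phi> + j (trace_on \<Omega> \<phi>))"
    using linear_form_subset[OF _ P1_diamond_subset] by simp
  then obtain u where u: "?P u"
    using galerkin_solution[OF order_refl function_space_P1_diamond definite_energy] by blast
  have "v = u" if "?P v" for v
    by (rule definite_form_unique[OF function_space_P1_diamond definite_energy]) (use u that in simp_all)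
  with u have "\<exists>!u. ?P u" by blast
  from theI'[OF this] have "?P (Neumann_h \<Omega> Q Th f j)" unfolding Neumann_h_def .
  then show "Neumann_h \<Omega> Q Th f j \<in> Vd"
    and "\<phi> \<in> Vd \<Longrightarrow> energy \<Omega> Q (Neumann_h \<Omega> Q Th f j) \<phi> = L2_inner \<Omega> f \<phi> + j (trace_on \<Omega> \<phi>)"
    by blast+
qed

lemma P1_zero_iff: "v \<in> V0 \<longleftrightarrow> v \<in> V \<and> trace_on \<Omega> v = (\<lambda>x. 0)"
  by (simp add: P1_zero_def)

lemma P1_zero_in_V: "v \<in> V0 \<Longrightarrow> v \<in> V"
  by (simp add: P1_zero_def)

lemma diff_in_P1_zero:
  assumes "u \<in> V" "v \<in> V" "trace_on \<Omega> u = trace_on \<Omega> v"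
  shows "(\<lambda>x. 1 * u x + (-1) * v x) \<in> V0"
  unfolding P1_zero_iff trace_on_lin
  using function_spaceD(2)[OF function_space_P1 assms(1,2), of 1 "-1"] assms(3) by simp

text \<open>Subtracting the lifting \<open>G\<close> turns the prescribed trace into zero trace; the
  correction \<open>z\<close> solves a definite problem on \<open>V0\<close> with load shifted by
  \<open>energy \<Omega> Q G\<close>.\<close>

lemma Dirichlet_h_solves:
  assumes f: "f \<in> L2 \<Omega>" and G: "G \<in> V" "trace_on \<Omega> G = g"
  shows "Dirichlet_h \<Omega> Q Th f g \<in> V" "trace_on \<Omega> (Dirichlet_h \<Omega> Q Th f g) = g"
    and "\<psi> \<in> V0 \<Longrightarrow> energy \<Omega> Q (Dirichlet_h \<Omega> Q Th f g) \<psi> = L2_inner \<Omega> f \<psi>"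
proof -
  let ?e = "energy \<Omega> Q"
  let ?P = "\<lambda>v. v \<in> V \<and> trace_on \<Omega> v = g \<and> (\<forall>\<psi>\<in>V0. ?e v \<psi> = L2_inner \<Omega> f \<psi>)"
  note fs = function_space_P1 and sym = symmetric_energy
  have "linear_form V (?e G)" using symmetric_energy G(1) unfolding symmetric_form_def by blast
  then have "linear_form V (\<lambda>\<psi>. 1 * L2_inner \<Omega> f \<psi> + (-1) * ?e G \<psi>)"
    by (intro linear_form_add linear_form_load f)
  then have "linear_form V0 (\<lambda>\<psi>. L2_inner \<Omega> f \<psi> - ?e G \<psi>)"
    using linear_form_subset[of V _ V0] P1_zero_in_V by (simp add: subset_iff)
  then obtain z where z: "z \<in> V0" "\<forall>\<psi>\<in>V0. ?e z \<psi> = L2_inner \<Omega> f \<psi> - ?e G \<psi>"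
    using galerkin_solution[OF P1_zero_subset function_space_P1_zero definite_energy_zero] by blast
  define v where "v = (\<lambda>x. 1 * G x + 1 * z x)"
  have zV: "z \<in> V" using z(1) by (rule P1_zero_in_V)
  have v: "?P v"
  proof (intro conjI ballI)
    show "v \<in> V" unfolding v_def by (rule function_spaceD(2)[OF fs G(1) zV])
    show "trace_on \<Omega> v = g" unfolding v_def trace_on_lin using z(1) G(2) by (simp add: P1_zero_def)
    fix \<psi> assume \<psi>: "\<psi> \<in> V0"
    have "?e v \<psi> = 1 * ?e G \<psi> + 1 * ?e z \<psi>"
      unfolding v_def by (rule symmetric_formD_left[OF fs sym G(1) zV P1_zero_in_V[OF \<psi>]])
    then show "?e v \<psi> = L2_inner \<Omega> f \<psi>" using z(2) \<psi> by simp
  qed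
  have "v' = v" if v': "?P v'" for v'
  proof -
    let ?d = "\<lambda>x. 1 * v' x + (-1) * v x"
    have d: "?d \<in> V0" using v v' by (intro diff_in_P1_zero) auto
    have "?e ?d ?d = 1 * ?e v' ?d + (-1) * ?e v ?d"
      using v v' P1_zero_in_V[OF d] by (intro symmetric_formD_left[OF fs sym]) auto
    also have "\<dots> = 0" using v v' d by simp
    finally have "?d = (\<lambda>x. 0)" using definite_energy_zero d unfolding definite_form_def by blast
    then have "1 * v' x + (-1) * v x = 0" for x by metis
    then show ?thesis by (simp add: fun_eq_iff)
  qed
  with v have "\<exists>!v. ?P v" by blast
  from theI'[OF this] have "?P (Dirichlet_h \<Omega> Q Th f g)" unfolding Dirichlet_h_def .
  then show "Dirichlet_h \<Omega> Q Th f g \<in> V" "trace_on \<Omega> (Dirichlet_h \<Omega> Q Th f g) = g"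
    and "\<psi> \<in> V0 \<Longrightarrow> energy \<Omega> Q (Dirichlet_h \<Omega> Q Th f g) \<psi> = L2_inner \<Omega> f \<psi>"
    by blast+
qed

text \<open>The space \<open>S\<close> of the overview: discretely Q-harmonic functions with
  vanishing boundary integral.\<close>

definition harmonic :: "(real^'n \<Rightarrow> real) set" where
  "harmonic = {w \<in> Vd. \<forall>\<psi>\<in>V0. energy \<Omega> Q w \<psi> = 0}"

lemma harmonic_subset: "harmonic \<subseteq> Vd"
  by (auto simp: harmonic_def)

lemma harmonic_in_V: "w \<in> harmonic \<Longrightarrow> w \<in> V"
  using harmonic_subset P1_diamond_subset by blast

lemma function_space_harmonic: "function_space harmonic"
  unfolding function_space_def
proof (intro conjI ballI allI)
  note fs = function_space_P1 and sym = symmetric_energy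
  have lin: "energy \<Omega> Q (\<lambda>x. a * u x + b * v x) \<psi> = a * energy \<Omega> Q u \<psi> + b * energy \<Omega> Q v \<psi>"
    if "u \<in> V" "v \<in> V" "\<psi> \<in> V0" for u v \<psi> a b
    using that P1_zero_in_V by (intro symmetric_formD_left[OF fs sym]) auto
  have zero: "(\<lambda>x. 0) \<in> Vd" by (rule function_spaceD(1)[OF function_space_P1_diamond])
  then have "(\<lambda>x. 0) \<in> V" using P1_diamond_subset by blast
  then have "energy \<Omega> Q (\<lambda>x. 0) \<psi> = 0" if "\<psi> \<in> V0" for \<psi>
    using lin[of "\<lambda>x. 0" "\<lambda>x. 0" \<psi> 0 0] that by simp
  with zero show "(\<lambda>x. 0) \<in> harmonic" by (simp add: harmonic_def)
  fix u v a b assume u: "u \<in> harmonic" and v: "v \<in> harmonic"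
  have "(\<lambda>x. a * u x + b * v x) \<in> Vd"
    using u v by (intro function_spaceD(2)[OF function_space_P1_diamond]) (auto simp: harmonic_def)
  moreover have "energy \<Omega> Q (\<lambda>x. a * u x + b * v x) \<psi> = 0" if "\<psi> \<in> V0" for \<psi>
    using lin[OF harmonic_in_V[OF u] harmonic_in_V[OF v] that] u v that by (simp add: harmonic_def)
  ultimately show "(\<lambda>x. a * u x + b * v x) \<in> harmonic" by (simp add: harmonic_def)
qed

text \<open>Both discrete solutions have the same source \<open>f\<close>, and \<open>j\<close> sees
  nothing of a zero trace, so their difference is orthogonal to \<open>V0\<close>.\<close>

lemma misfit_harmonic:
  assumes f: "f \<in> L2 \<Omega>" and j: "j \<in> H_minus_half \<Omega>"
    and G: "G \<in> V" "trace_on \<Omega> G = g" "boundary_integral \<Omega> g = 0"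
  defines "w \<equiv> (\<lambda>x. Neumann_h \<Omega> Q Th f j x - Dirichlet_h \<Omega> Q Th f g x)"
  shows "w \<in> harmonic"
    and "\<phi> \<in> harmonic \<Longrightarrow> energy \<Omega> Q w \<phi> = L2_inner \<Omega> f \<phi> + (j (trace_on \<Omega> \<phi>) - energy \<Omega> Q G \<phi>)"
proof -
  let ?e = "energy \<Omega> Q"
  note fs = function_space_P1 and sym = symmetric_energy
  define N where "N = Neumann_h \<Omega> Q Th f j"
  define D where "D = Dirichlet_h \<Omega> Q Th f g"
  note N = Neumann_h_solves[OF f j, folded N_def] and D = Dirichlet_h_solves[OF f G(1,2), folded D_def]
  have NV: "N \<in> V" using N(1) P1_diamond_subset by blast
  \<comment> \<open>Here the zero mean of \<open>g\<close> enters: otherwise the misfit would leave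
    \<open>Vd\<close>.\<close>
  have DVd: "D \<in> Vd" using D(1,2) G(3) by (simp add: P1_diamond_def)
  have w: "w = (\<lambda>x. 1 * N x + (-1) * D x)" by (simp add: w_def N_def D_def)
  have e_w: "?e w \<phi> = ?e N \<phi> - ?e D \<phi>" if "\<phi> \<in> V" for \<phi>
    unfolding w using symmetric_formD_left[OF fs sym NV D(1) that, of 1 "-1"] by simp
  show "w \<in> harmonic"
    unfolding harmonic_def
  proof (intro CollectI conjI ballI)
    show "w \<in> Vd" unfolding w by (rule function_spaceD(2)[OF function_space_P1_diamond N(1) DVd])
    fix \<psi> assume \<psi>: "\<psi> \<in> V0"
    have "\<psi> \<in> Vd" using \<psi> P1_zero_subset by blast
    moreover have "j (trace_on \<Omega> \<psi>) = 0"
    proof -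
      have "linear_form V (\<lambda>v. j (trace_on \<Omega> v))" by (rule linear_form_trace[OF j])
      from linear_form_zero[OF this fs] have "j (\<lambda>x. 0) = 0" by (simp only: trace_zero)
      then show ?thesis using \<psi> by (simp add: P1_zero_def)
    qed
    ultimately show "?e w \<psi> = 0"
      using e_w[OF P1_zero_in_V[OF \<psi>]] N(2) D(3)[OF \<psi>] by simp
  qed
  assume \<phi>: "\<phi> \<in> harmonic"
  then have \<phi>V: "\<phi> \<in> V" "\<phi> \<in> Vd" using harmonic_in_V harmonic_subset by blast+
  \<comment> \<open>\<open>D\<close> and \<open>G\<close> share the trace \<open>g\<close>, so
    against a harmonic test function \<open>D\<close> may be replaced by \<open>G\<close>. This
    removes the dependence of \<open>D\<close> on \<open>f\<close>.\<close>
  have diff: "(\<lambda>x. 1 * D x + (-1) * G x) \<in> V0"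
    using D(1,2) G by (intro diff_in_P1_zero) auto
  have "?e \<phi> (\<lambda>x. 1 * D x + (-1) * G x) = 1 * ?e \<phi> D + (-1) * ?e \<phi> G"
    by (rule symmetric_formD(2)[OF sym D(1) G(1) \<phi>V(1)])
  then have "?e \<phi> D = ?e \<phi> G" using \<phi> diff by (simp add: harmonic_def)
  then have "?e D \<phi> = ?e G \<phi>"
    using symmetric_formD(1)[OF sym \<phi>V(1)] D(1) G(1) by simp
  then show "?e w \<phi> = L2_inner \<Omega> f \<phi> + (j (trace_on \<Omega> \<phi>) - ?e G \<phi>)"
    using e_w[OF \<phi>V(1)] N(2)[OF \<phi>V(2)] by simp
qed

text \<open>Used with \<open>c = 1 / \<rho>\<close>; the redundant-looking factor \<open>1\<close>
  gives the form the shape of \<open>linear_form_add\<close>.\<close>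

lemma definite_add_L2:
  assumes c: "0 \<le> c"
  shows "definite_form harmonic (\<lambda>u v. 1 * energy \<Omega> Q u v + c * L2_inner \<Omega> u v)"
proof -
  have def: "definite_form harmonic (energy \<Omega> Q)"
    by (rule definite_form_subset[OF definite_energy harmonic_subset])
  have "harmonic \<subseteq> L2 \<Omega>" using harmonic_in_V P1_in_L2 by blast
  then have L2: "symmetric_form harmonic (L2_inner \<Omega>)"
    by (rule symmetric_form_subset[OF symmetric_L2_inner])
  show ?thesis
    unfolding definite_form_def
  proof (intro conjI ballI impI)
    show "symmetric_form harmonic (\<lambda>u v. 1 * energy \<Omega> Q u v + c * L2_inner \<Omega> u v)"
      using def L2 linear_form_add[of harmonic _ _ 1 c] unfolding definite_form_def symmetric_form_def by simp
    fix u assume u: "u \<in> harmonic"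
    have e: "0 \<le> energy \<Omega> Q u u" using def u by (simp add: definite_form_def)
    have l: "0 \<le> c * L2_inner \<Omega> u u" by (intro mult_nonneg_nonneg c L2_inner_self_nonneg)
    show "0 \<le> 1 * energy \<Omega> Q u u + c * L2_inner \<Omega> u u" using e l by simp
    assume "1 * energy \<Omega> Q u u + c * L2_inner \<Omega> u u = 0"
    then have "energy \<Omega> Q u u = 0" using e l by linarith
    then show "u = (\<lambda>x. 0)" using def u by (simp add: definite_form_def)
  qed
qed

text \<open>The growth term with \<open>(f' x - f x)\<^sup>2\<close> is kept in the conclusion
  because it yields uniqueness of the minimizer as well as minimality.\<close>

lemma minimizer_exists_unique:
  assumes \<rho>: "0 < \<rho>" and fstar: "fstar \<in> L2 \<Omega>" and j: "j \<in> H_minus_half \<Omega>"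
    and G: "G \<in> V" "trace_on \<Omega> G = g" "boundary_integral \<Omega> g = 0"
  shows "\<exists>f\<in>L2 \<Omega>.
    (\<forall>f'\<in>L2 \<Omega>. Upsilon_h \<Omega> Q Th \<rho> fstar j g f + \<rho> * integral\<^sup>L LO (\<lambda>x. (f' x - f x)\<^sup>2)
      \<le> Upsilon_h \<Omega> Q Th \<rho> fstar j g f') \<and>
    (\<forall>x. f x - fstar x = - (1 / \<rho>) * (Neumann_h \<Omega> Q Th f j x - Dirichlet_h \<Omega> Q Th f g x))"
proof -
  let ?e = "energy \<Omega> Q" and ?L = "L2_inner \<Omega>"
  define w where "w f = (\<lambda>x. Neumann_h \<Omega> Q Th f j x - Dirichlet_h \<Omega> Q Th f g x)" for f
  define l where "l \<phi> = j (trace_on \<Omega> \<phi>) - ?e G \<phi>" for \<phi>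
  have w: "w f \<in> harmonic" "\<And>\<phi>. \<phi> \<in> harmonic \<Longrightarrow> ?e (w f) \<phi> = ?L f \<phi> + l \<phi>" if "f \<in> L2 \<Omega>" for f
    using misfit_harmonic[OF that j G] unfolding w_def l_def by blast+
  note fsH = function_space_harmonic and fsL = function_space_L2[of \<Omega>] and symL = symmetric_L2_inner[of \<Omega>]
  have defH: "definite_form harmonic ?e"
    by (rule definite_form_subset[OF definite_energy harmonic_subset])
  then have symH: "symmetric_form harmonic ?e" by (simp add: definite_form_def)
  have HL: "\<phi> \<in> L2 \<Omega>" if "\<phi> \<in> harmonic" for \<phi> using harmonic_in_V[OF that] by (rule P1_in_L2)
  have HV: "harmonic \<subseteq> V" using harmonic_in_V by blast
  have "linear_form V (?e G)" using symmetric_energy G(1) unfolding symmetric_form_def by blast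
  then have "linear_form V (\<lambda>\<phi>. 1 * ?L fstar \<phi> + 1 * (1 * j (trace_on \<Omega> \<phi>) + (-1) * ?e G \<phi>))"
    by (intro linear_form_add linear_form_load linear_form_trace fstar j)
  from linear_form_subset[OF this HV] have "linear_form harmonic (\<lambda>\<phi>. ?L fstar \<phi> + l \<phi>)"
    by (simp add: l_def)
  then obtain u where u: "u \<in> harmonic"
    and u_eq: "\<forall>\<phi>\<in>harmonic. 1 * ?e u \<phi> + (1 / \<rho>) * ?L u \<phi> = ?L fstar \<phi> + l \<phi>"
    using galerkin_solution[OF harmonic_subset fsH definite_add_L2[of "1 / \<rho>"]] \<rho> by auto
  \<comment> \<open>The optimality condition is taken as the definition of \<open>f\<close>, which
    makes it hold at every point. It remains to show that the misfit of this \<open>f\<close> is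
    \<open>u\<close> itself.\<close>
  define f where "f = (\<lambda>x. 1 * fstar x + (- (1 / \<rho>)) * u x)"
  have f: "f \<in> L2 \<Omega>" unfolding f_def by (rule function_spaceD(2)[OF fsL fstar HL[OF u]])
  have wf: "w f = u"
  proof (rule definite_form_unique[OF fsH defH w(1)[OF f] u])
    fix \<phi> assume \<phi>: "\<phi> \<in> harmonic"
    have "?L f \<phi> = 1 * ?L fstar \<phi> + (- (1 / \<rho>)) * ?L u \<phi>"
      unfolding f_def by (rule symmetric_formD_left[OF fsL symL fstar HL[OF u] HL[OF \<phi>]])
    then show "?e (w f) \<phi> = ?e u \<phi>" using w(2)[OF f \<phi>] bspec[OF u_eq \<phi>] by simp
  qed
  have Ups: "Upsilon_h \<Omega> Q Th \<rho> fstar j g f' = ?e (w f') (w f') + \<rho> * ?L (\<lambda>x. f' x - fstar x) (\<lambda>x. f' x - fstar x)" for f'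
    by (simp add: Upsilon_h_def J_h_def w_def L2_inner_def power2_eq_square Let_def)
  have Ups_f: "Upsilon_h \<Omega> Q Th \<rho> fstar j g f = ?e u u + (1 / \<rho>) * ?L u u"
  proof -
    have "(\<lambda>x. f x - fstar x) = (\<lambda>x. (- (1 / \<rho>)) * u x)" by (simp add: f_def fun_eq_iff)
    moreover have "?L (\<lambda>x. (- (1 / \<rho>)) * u x) (\<lambda>x. (- (1 / \<rho>)) * u x) = (1 / \<rho>)\<^sup>2 * ?L u u"
      using form_square_add[OF fsL symL HL[OF u] HL[OF u], of "- (1 / \<rho>)" 0] by simp
    ultimately show ?thesis
      using \<rho> unfolding Ups wf by (simp add: power2_eq_square)
  qed
  show ?thesis
  proof (intro bexI[OF _ f] conjI ballI allI)
    fix f' assume f': "f' \<in> L2 \<Omega>"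
    define \<eta> where "\<eta> = (\<lambda>x. 1 * f' x + (-1) * f x)"
    have \<eta>: "\<eta> \<in> L2 \<Omega>" unfolding \<eta>_def by (rule function_spaceD(2)[OF fsL f' f])
    define d where "d = (\<lambda>x. 1 * w f' x + (-1) * u x)"
    have d: "d \<in> harmonic" unfolding d_def by (rule function_spaceD(2)[OF fsH w(1)[OF f'] u])
    \<comment> \<open>\<open>u\<close> is itself harmonic and may be used as test function; in the
      difference of the two identities \<open>l\<close> cancels.\<close>
    have "?e d u = 1 * ?e (w f') u + (-1) * ?e u u"
      unfolding d_def by (rule symmetric_formD_left[OF fsH symH w(1)[OF f'] u u])
    also have "\<dots> = ?L f' u - ?L f u"
      using w(2)[OF f' u] w(2)[OF f u] unfolding wf by simp
    also have "\<dots> = ?L \<eta> u"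
      unfolding \<eta>_def using symmetric_formD_left[OF fsL symL f' f HL[OF u], of 1 "-1"] by simp
    finally have edu: "?e d u = ?L \<eta> u" .
    have "w f' = (\<lambda>x. 1 * d x + 1 * u x)" by (simp add: d_def)
    then have J: "?e (w f') (w f') = ?e d d + 2 * ?L \<eta> u + ?e u u"
      using form_square_add[OF fsH symH d u, of 1 1] edu by simp
    have "(\<lambda>x. f' x - fstar x) = (\<lambda>x. 1 * \<eta> x + (- (1 / \<rho>)) * u x)"
      by (simp add: \<eta>_def f_def fun_eq_iff)
    then have Lk: "?L (\<lambda>x. f' x - fstar x) (\<lambda>x. f' x - fstar x) = ?L \<eta> \<eta> - 2 * (1 / \<rho>) * ?L \<eta> u + (1 / \<rho>)\<^sup>2 * ?L u u"
      using form_square_add[OF fsL symL \<eta> HL[OF u], of 1 "- (1 / \<rho>)"] by simp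
    have "\<rho> * ?L (\<lambda>x. f' x - fstar x) (\<lambda>x. f' x - fstar x)
        = \<rho> * ?L \<eta> \<eta> - 2 * ?L \<eta> u + (1 / \<rho>) * ?L u u"
      unfolding Lk using \<rho> by (simp add: power2_eq_square field_simps)
    \<comment> \<open>The cross terms \<open>2 * ?L \<eta> u\<close> of misfit and penalty cancel;
      this is the first-order condition at \<open>f\<close>.\<close>
    then have "Upsilon_h \<Omega> Q Th \<rho> fstar j g f' = Upsilon_h \<Omega> Q Th \<rho> fstar j g f + ?e d d + \<rho> * ?L \<eta> \<eta>"
      unfolding Ups_f unfolding Ups J by simp
    moreover have "0 \<le> ?e d d" using defH d by (simp add: definite_form_def)
    moreover have "?L \<eta> \<eta> = integral\<^sup>L LO (\<lambda>x. (f' x - f x)\<^sup>2)"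
      by (simp add: L2_inner_def \<eta>_def power2_eq_square)
    ultimately show "Upsilon_h \<Omega> Q Th \<rho> fstar j g f + \<rho> * integral\<^sup>L LO (\<lambda>x. (f' x - f x)\<^sup>2)
      \<le> Upsilon_h \<Omega> Q Th \<rho> fstar j g f'" by simp
  next
    fix x
    have "Neumann_h \<Omega> Q Th f j x - Dirichlet_h \<Omega> Q Th f g x = u x"
      using fun_cong[OF wf, of x] by (simp only: w_def)
    then show "f x - fstar x = - (1 / \<rho>) * (Neumann_h \<Omega> Q Th f j x - Dirichlet_h \<Omega> Q Th f g x)"
      by (simp add: f_def)
  qed
qed

end

theorem theorem3p2:
  fixes \<Omega> :: "(real^'n) set" and Q :: "real^'n \<Rightarrow> real^'n^'n" and qlow :: real
    and \<T> :: "real \<Rightarrow> (real^'n) set set" and h \<rho> :: real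
    and fstar :: "real^'n \<Rightarrow> real" and j :: "(real^'n \<Rightarrow> real) \<Rightarrow> real"
    and g :: "real^'n \<Rightarrow> real"
  assumes dim: "CARD('n) = 2 \<or> CARD('n) = 3"
    and dom: "open \<Omega>" "bounded \<Omega>" "connected \<Omega>" "\<Omega> \<noteq> {}" "lipschitz_boundary \<Omega>"
    and coeff: "admissible_coefficient \<Omega> Q qlow"
    and mesh: "regular_quasi_uniform_family \<Omega> \<T>"
    and h: "0 < h" "h < 1"
    and rho: "0 < \<rho>"
    and fstar: "fstar \<in> L2 \<Omega>"
    and j: "j \<in> H_minus_half \<Omega>"
    and g: "g \<in> H_half_diamond \<Omega>" "g \<in> trace_on \<Omega> ` P1 \<Omega> (\<T> h)"
  shows "\<exists>f\<in>L2 \<Omega>.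
           (\<forall>f'\<in>L2 \<Omega>. Upsilon_h \<Omega> Q (\<T> h) \<rho> fstar j g f \<le> Upsilon_h \<Omega> Q (\<T> h) \<rho> fstar j g f') \<and>
           (\<forall>f'\<in>L2 \<Omega>. (\<forall>f''\<in>L2 \<Omega>. Upsilon_h \<Omega> Q (\<T> h) \<rho> fstar j g f' \<le> Upsilon_h \<Omega> Q (\<T> h) \<rho> fstar j g f'')
                 \<longrightarrow> (AE x in lebesgue_on \<Omega>. f' x = f x)) \<and>
           (AE x in lebesgue_on \<Omega>.
              f x - fstar x = - (1 / \<rho>) * (Neumann_h \<Omega> Q (\<T> h) f j x - Dirichlet_h \<Omega> Q (\<T> h) f g x))"
proof -
  have "triangulation (\<T> h) \<and> \<Union>(\<T> h) = closure \<Omega> \<and> (\<forall>T\<in>\<T> h. int CARD('n) simplex T)"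
    using mesh h unfolding regular_quasi_uniform_family_def by blast
  \<comment> \<open>Finiteness of the mesh is part of \<open>triangulation\<close>.\<close>
  then interpret fem_setting \<Omega> Q qlow "\<T> h"
    using dim dom coeff by unfold_locales (auto simp: triangulation_def)
  obtain G where G: "G \<in> P1 \<Omega> (\<T> h)" "trace_on \<Omega> G = g" using g(2) by blast
  have "boundary_integral \<Omega> g = 0" using g(1) by (simp add: H_half_diamond_def)
  from minimizer_exists_unique[OF rho fstar j G this] obtain f where f: "f \<in> L2 \<Omega>"
    and min: "\<forall>f'\<in>L2 \<Omega>. Upsilon_h \<Omega> Q (\<T> h) \<rho> fstar j g f + \<rho> * integral\<^sup>L (lebesgue_on \<Omega>) (\<lambda>x. (f' x - f x)\<^sup>2)
      \<le> Upsilon_h \<Omega> Q (\<T> h) \<rho> fstar j g f'"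
    and eq: "\<forall>x. f x - fstar x = - (1 / \<rho>) * (Neumann_h \<Omega> Q (\<T> h) f j x - Dirichlet_h \<Omega> Q (\<T> h) f g x)"
    by blast
  show ?thesis
  proof (intro bexI[OF _ f] conjI ballI impI)
    fix f' assume f': "f' \<in> L2 \<Omega>"
    have "0 \<le> \<rho> * integral\<^sup>L (lebesgue_on \<Omega>) (\<lambda>x. (f' x - f x)\<^sup>2)"
      using rho by (intro mult_nonneg_nonneg Bochner_Integration.integral_nonneg) auto
    then show "Upsilon_h \<Omega> Q (\<T> h) \<rho> fstar j g f \<le> Upsilon_h \<Omega> Q (\<T> h) \<rho> fstar j g f'"
      using bspec[OF min f'] by linarith
  next
    fix f' assume f': "f' \<in> L2 \<Omega>"
      and "\<forall>f''\<in>L2 \<Omega>. Upsilon_h \<Omega> Q (\<T> h) \<rho> fstar j g f' \<le> Upsilon_h \<Omega> Q (\<T> h) \<rho> fstar j g f''"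
    then have "Upsilon_h \<Omega> Q (\<T> h) \<rho> fstar j g f' \<le> Upsilon_h \<Omega> Q (\<T> h) \<rho> fstar j g f" using f by blast
    \<comment> \<open>A second minimizer has no larger value than \<open>f\<close>, so the growth
      estimate leaves no room for a positive L2 distance; equality follows almost
      everywhere.\<close>
    with bspec[OF min f'] have "\<rho> * integral\<^sup>L (lebesgue_on \<Omega>) (\<lambda>x. (f' x - f x)\<^sup>2) \<le> 0" by linarith
    then have le: "integral\<^sup>L (lebesgue_on \<Omega>) (\<lambda>x. (f' x - f x)\<^sup>2) \<le> 0" using rho by (simp add: mult_le_0_iff)
    have int: "integrable (lebesgue_on \<Omega>) (\<lambda>x. (f' x - f x)\<^sup>2)"
      using function_spaceD(2)[OF function_space_L2 f' f, of 1 "-1"] by (simp add: L2_def)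
    have "integral\<^sup>L (lebesgue_on \<Omega>) (\<lambda>x. (f' x - f x)\<^sup>2) = 0"
      by (rule antisym[OF le]) (intro Bochner_Integration.integral_nonneg, simp)
    then have "AE x in lebesgue_on \<Omega>. (f' x - f x)\<^sup>2 = 0"
      using integral_nonneg_eq_0_iff_AE[OF int] by simp
    then show "AE x in lebesgue_on \<Omega>. f' x = f x" by eventually_elim simp
  next
    show "AE x in lebesgue_on \<Omega>. f x - fstar x = - (1 / \<rho>) * (Neumann_h \<Omega> Q (\<T> h) f j x - Dirichlet_h \<Omega> Q (\<T> h) f g x)"
      using eq by (intro AE_I2) blast
  qed
qed

end
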